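(* There exist a probability space $(\Omega,\mathcal{F},\mathbb{P})$, an invertible, bimeasurable, measure-preserving transformation $T:\Omega\to\Omega$, a sub-sigma-algebra $\mathcal{F}_0\subset\mathcal{F}$ generating a $T$-filtration $(\mathcal{F}_k)_{k\in\mathbb{Z}}=(T^{-k}\mathcal{F}_0)_{k\in\mathbb{Z}}$, and a stationary, square-integrable, real-valued process $(X_k)_{k\in\mathbb{Z}}=(X_0\circ T^k)_{k\in\mathbb{Z}}$ which is $(\mathcal{F}_k)_{k\in\mathbb{Z}}$-adapted, regular, and admits a spectral density, such that $E_0:=E[\,\cdot\,|\mathcal{F}_0]$ is regular and, for any decomposition $\{\mathbb{P}_\omega\}_{\omega\in\Omega}$ of $E_0$, the sequence $$Z_n(\theta)=\frac{1}{\sqrt n}S_n(\theta)=\frac{1}{\sqrt n}\sum_{k=0}^{n-1}X_ke^{ik\theta}$$ admits no limit in distribution (as $n\to\infty$) under $\mathbb{P}_\omega$ for every $\theta\in[0,2\pi)$ and $\mathbb{P}$-a.e. $\omega$.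
   Context: $T$-filtration: a filtration of the form $\mathcal{F}_k=T^{-k}\mathcal{F}_0$ ($k\in\mathbb{Z}$), where $\mathcal{F}_0\subset\mathcal{F}$ is a sub-sigma-algebra with $\mathcal{F}_0\subset T^{-1}\mathcal{F}_0$. The process is adapted if $X_0$ is $\mathcal{F}_0$-measurable. Regular process: $(X_k)_{k\in\mathbb{Z}}$ is regular if $\lim_{k\to\infty}E\bigl[|E[X_0|\mathcal{F}_{-k}]|^2\bigr]=0$. Spectral density: with $\lambda$ the normalized Lebesgue measure on $[0,2\pi)$, a nonnegative $f\in L^1_\lambda$ with $\int_0^{2\pi}f(\theta)e^{ik\theta}\,d\lambda(\theta)=E[(X_0-EX_0)\overline{(X_k-EX_0)}]$ for all $k\in\mathbb{Z}$. Regular conditional expectation: $E_0$ is regular if there is a family $\{\mathbb{P}_\omega\}_{\omega\in\Omega}$ of probability measures on $(\Omega,\mathcal{F})$ (a decomposition of $E_0$) such that for every $\mathbb{P}$-integrable $X:\Omega\to\mathbb{R}$ the function $\omega\mapsto\int X\,d\mathbb{P}_\omega$ (set to $0$ where the integral makes no sense) is an $\mathcal{F}_0$-measurable version of $E_0X$. *)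

theory Defs
  imports "HOL-Probability.Probability"
begin

definition automorphism_of :: "'a measure \<Rightarrow> ('a \<Rightarrow> 'a) \<Rightarrow> bool" where
  "automorphism_of M T \<longleftrightarrow>
     bij_betw T (space M) (space M) \<and>
     T \<in> measurable M M \<and>
     inv_into (space M) T \<in> measurable M M \<and>
     distr M M T = M"

definition iterate :: "'a measure \<Rightarrow> ('a \<Rightarrow> 'a) \<Rightarrow> int \<Rightarrow> 'a \<Rightarrow> 'a" where
  "iterate M T k =
     (if 0 \<le> k then T ^^ nat k else inv_into (space M) T ^^ nat (- k))"

text \<open>Sub-sigma-algebras are represented, as in the library's theory of conditional expectation,
  by measures of which only the underlying set and the measurable sets matter. The sigma-algebra
  \<open>T\<^sup>-\<^sup>k F0\<close> consists of the preimages of the sets of \<open>F0\<close> under \<open>iterate M T k\<close>.\<close>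

definition filt :: "'a measure \<Rightarrow> ('a \<Rightarrow> 'a) \<Rightarrow> 'a measure \<Rightarrow> int \<Rightarrow> 'a measure" where
  "filt M T F0 k = vimage_algebra (space M) (iterate M T k) F0"

definition generates_filtration :: "'a measure \<Rightarrow> ('a \<Rightarrow> 'a) \<Rightarrow> 'a measure \<Rightarrow> bool" where
  "generates_filtration M T F0 \<longleftrightarrow>
     subalgebra M F0 \<and> sets F0 \<subseteq> sets (filt M T F0 1)"

definition process :: "'a measure \<Rightarrow> ('a \<Rightarrow> 'a) \<Rightarrow> ('a \<Rightarrow> real) \<Rightarrow> int \<Rightarrow> 'a \<Rightarrow> real" where
  "process M T X0 k \<omega> = X0 (iterate M T k \<omega>)"

definition stationary :: "'a measure \<Rightarrow> (int \<Rightarrow> 'a \<Rightarrow> real) \<Rightarrow> bool" where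
  "stationary M X \<longleftrightarrow>
     (\<forall>k. X k \<in> borel_measurable M) \<and>
     (\<forall>h. distr M (PiM UNIV (\<lambda>_. borel)) (\<lambda>\<omega> k. X (k + h) \<omega>) =
          distr M (PiM UNIV (\<lambda>_. borel)) (\<lambda>\<omega> k. X k \<omega>))"

definition square_integrable :: "'a measure \<Rightarrow> (int \<Rightarrow> 'a \<Rightarrow> real) \<Rightarrow> bool" where
  "square_integrable M X \<longleftrightarrow>
     (\<forall>k. X k \<in> borel_measurable M \<and> integrable M (\<lambda>\<omega>. (X k \<omega>)\<^sup>2))"

definition adapted :: "(int \<Rightarrow> 'a measure) \<Rightarrow> (int \<Rightarrow> 'a \<Rightarrow> real) \<Rightarrow> bool" where
  "adapted F X \<longleftrightarrow> (\<forall>k. X k \<in> borel_measurable (F k))"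

definition regular_process ::
    "'a measure \<Rightarrow> (int \<Rightarrow> 'a measure) \<Rightarrow> (int \<Rightarrow> 'a \<Rightarrow> real) \<Rightarrow> bool" where
  "regular_process M F X \<longleftrightarrow>
     (\<lambda>k::nat. \<integral>\<omega>. \<bar>real_cond_exp M (F (- int k)) (X 0) \<omega>\<bar>\<^sup>2 \<partial>M) \<longlonglongrightarrow> 0"

text \<open>The measure \<open>uniform_measure lborel {0..<2 * pi}\<close> is the normalized Lebesgue measure on
  \<open>[0, 2\<pi>)\<close>, and \<open>cis t\<close> is \<open>exp (\<i> * t)\<close>. No conjugate appears in the covariance because
  the process is real-valued.\<close>

definition spectral_density ::
    "'a measure \<Rightarrow> (int \<Rightarrow> 'a \<Rightarrow> real) \<Rightarrow> (real \<Rightarrow> real) \<Rightarrow> bool" where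
  "spectral_density M X f \<longleftrightarrow>
     (\<forall>\<theta>\<in>{0..<2 * pi}. 0 \<le> f \<theta>) \<and>
     integrable (uniform_measure lborel {0..<2 * pi}) f \<and>
     (\<forall>k::int.
        (\<integral>\<theta>. complex_of_real (f \<theta>) * cis (of_int k * \<theta>) \<partial>uniform_measure lborel {0..<2 * pi}) =
        complex_of_real
          (\<integral>\<omega>. (X 0 \<omega> - (\<integral>\<omega>'. X 0 \<omega>' \<partial>M)) * (X k \<omega> - (\<integral>\<omega>'. X 0 \<omega>' \<partial>M)) \<partial>M))"

text \<open>The Bochner integral is \<open>0\<close> for functions that are not integrable, which is the convention
  needed for \<open>\<integral>x. Y x \<partial>P \<omega>\<close>.\<close>

definition decomposition :: "'a measure \<Rightarrow> 'a measure \<Rightarrow> ('a \<Rightarrow> 'a measure) \<Rightarrow> bool" where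
  "decomposition M F0 P \<longleftrightarrow>
     (\<forall>\<omega>\<in>space M. prob_space (P \<omega>) \<and> sets (P \<omega>) = sets M) \<and>
     (\<forall>Y::'a \<Rightarrow> real. integrable M Y \<longrightarrow>
        (\<lambda>\<omega>. \<integral>x. Y x \<partial>P \<omega>) \<in> borel_measurable F0 \<and>
        (AE \<omega> in M. (\<integral>x. Y x \<partial>P \<omega>) = real_cond_exp M F0 Y \<omega>))"

definition regular_cond_exp :: "'a measure \<Rightarrow> 'a measure \<Rightarrow> bool" where
  "regular_cond_exp M F0 \<longleftrightarrow> (\<exists>P. decomposition M F0 P)"

definition Z :: "(int \<Rightarrow> 'a \<Rightarrow> real) \<Rightarrow> real \<Rightarrow> nat \<Rightarrow> 'a \<Rightarrow> complex" where
  "Z X \<theta> n \<omega> =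
     (1 / complex_of_real (sqrt (real n))) *
     (\<Sum>k<n. complex_of_real (X (int k) \<omega>) * cis (real k * \<theta>))"

text \<open>The library's \<open>weak_conv_m\<close> is phrased with distribution functions and only covers
  real-valued random variables, whereas the discrete Fourier transforms are complex-valued.\<close>

definition converges_in_distribution ::
    "'a measure \<Rightarrow> (nat \<Rightarrow> 'a \<Rightarrow> 'b::metric_space) \<Rightarrow> 'b measure \<Rightarrow> bool" where
  "converges_in_distribution M W N \<longleftrightarrow>
     (\<forall>g::'b \<Rightarrow> real. continuous_on UNIV g \<and> bounded (range g) \<longrightarrow>
        (\<lambda>n. \<integral>x. g (W n x) \<partial>M) \<longlonglongrightarrow> (\<integral>y. g y \<partial>N))"

definition has_limit_in_distribution ::
    "'a measure \<Rightarrow> (nat \<Rightarrow> 'a \<Rightarrow> 'b::metric_space) \<Rightarrow> bool" where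
  "has_limit_in_distribution M W \<longleftrightarrow>
     (\<exists>N. prob_space N \<and> sets N = sets borel \<and> converges_in_distribution M W N)"

end

theory Submission
  imports Defs "HOL-Library.Discrete_Functions"
begin

text \<open>The example is a white noise whose future is leaked in small doses. Let \<open>x\<^sub>k\<close> and \<open>t\<^sub>k\<close>
(\<open>k \<in> \<int>\<close>) be independent standard normal variables, stored as the even and the odd coordinates of
a point of \<open>int \<Rightarrow> real\<close>, and let \<open>T\<close> move every site one step, that is, every coordinate two
steps. The process is \<open>X\<^sub>k = x\<^sub>k\<close>, so it is i.i.d. with constant spectral density. The
sigma-algebra \<open>F0\<close> knows all the marks \<open>t\<^sub>k\<close>, the values \<open>x\<^sub>k\<close> for \<open>k \<le> 0\<close>, and, for \<open>k > 0\<close>,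
the value \<open>x\<^sub>k\<close> exactly when \<open>t\<^sub>k \<ge> \<rho> k\<close>, where \<open>\<rho>\<close> is nondecreasing and unbounded.
Hence \<open>E[X\<^sub>k | F0] = x\<^sub>k 1{t\<^sub>k \<ge> \<rho> k}\<close> for \<open>k > 0\<close>. Monotonicity of \<open>\<rho>\<close> makes the
information grow with time, and \<open>\<rho> \<longlongrightarrow> \<infinity>\<close> makes the process regular.

The revealed values form a random set that depends on the marks only, so conditioning on \<open>F0\<close> means
keeping what is revealed and drawing everything else afresh from the same product law
(\<open>cond_exp_by_resampling\<close>, \<open>law_of_resample\<close>). This gives an explicit decomposition.
Under it \<open>Z\<^sub>n(\<theta>)\<close> is a constant, the normalized sum \<open>V\<^sub>n / \<surd>n\<close> of the revealed terms, plus a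
centred variable with second moment at most 1. If \<open>V\<^sub>n / \<surd>n\<close> is unbounded, then
\<open>Z\<^sub>n(\<theta>)\<close> is not tight and has no limit in distribution (\<open>no_limit_if_means_unbounded\<close>).

That \<open>V\<^sub>n / \<surd>n\<close> is almost surely unbounded is an effect of the kind of the law of the iterated
logarithm. Its second moment tends to 0, but there are infinitely many independent scales on which
it can be large. Let \<open>\<rho>\<close> have the constant value \<open>l i\<close> on the dyadic block \<open>2\<^sup>i \<le> k < 2\<^sup>i\<^sup>+\<^sup>1\<close>.
Given the marks, the part of \<open>V\<^sub>n\<close> in that block is Gaussian, with variance of order \<open>2\<^sup>i\<close> with
positive probability. The increment over the block therefore exceeds \<open>l i \<surd>(2\<^sup>i\<^sup>+\<^sup>1)\<close> with a probability
bounded below by a positive number that depends on \<open>l i\<close> but neither on \<open>\<theta>\<close> nor otherwise on \<open>i\<close>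
(\<open>masked_sum_tail\<close>). If \<open>l\<close> tends to infinity slowly enough, these probabilities have a
divergent sum (\<open>slow_divergent_choice\<close>), and the second Borel-Cantelli lemma applies.

Another decomposition has conditional laws for which the integrals of any given integrable function agree
almost surely with those of the explicit one. The argument against a limit uses countably
many test functions of \<open>Z\<^sub>n(\<theta>)\<close>, so it carries over to every decomposition (\<open>no_quenched_limit\<close>).\<close>

section \<open>Conditional expectation by resampling\<close>

text \<open>The map \<open>R\<close> is the observation and \<open>C x y\<close> keeps the observed part of \<open>x\<close> and takes the rest
  from \<open>y\<close>. If \<open>y\<close> is an independent copy of \<open>x\<close>, the point \<open>C x y\<close> has the law of \<open>x\<close> and leads to the
  same observation. An event \<open>A\<close> of the observed sigma-algebra thus contains \<open>C x y\<close> exactly when it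
  contains \<open>x\<close>, and the integral of \<open>Y\<close> over \<open>A\<close> does not change when \<open>Y x\<close> is replaced by \<open>Y (C x y)\<close>.
  The map \<open>G\<close> recovers from the observation all that \<open>C\<close> uses of its first argument, which makes the
  integral over \<open>y\<close> measurable with respect to the observation.\<close>

lemma (in prob_space) cond_exp_by_resampling:
  fixes R G :: "'a \<Rightarrow> 'a" and C :: "'a \<Rightarrow> 'a \<Rightarrow> 'a" and Y :: "'a \<Rightarrow> real"
  assumes R [measurable]: "R \<in> measurable M M"
    and G [measurable]: "G \<in> measurable M M"
    and C [measurable]: "case_prod C \<in> measurable (M \<Otimes>\<^sub>M M) M"
    and law: "distr (M \<Otimes>\<^sub>M M) M (case_prod C) = M"
    and RC: "\<And>x y. x \<in> space M \<Longrightarrow> y \<in> space M \<Longrightarrow> R (C x y) = R x"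
    and CG: "\<And>x y. x \<in> space M \<Longrightarrow> y \<in> space M \<Longrightarrow> C (G (R x)) y = C x y"
    and Y: "integrable M Y"
  shows "(\<lambda>x. \<integral>y. Y (C x y) \<partial>M) \<in> borel_measurable (vimage_algebra (space M) R M)"
    and "AE x in M. real_cond_exp M (vimage_algebra (space M) R M) Y x = (\<integral>y. Y (C x y) \<partial>M)"
proof -
  let ?F = "vimage_algebra (space M) R M"
  interpret MM: pair_sigma_finite M M ..
  have Rsp: "R \<in> space M \<rightarrow> space M" by (rule funcsetI) (rule measurable_space[OF R])
  have [measurable]: "Y \<in> borel_measurable M" using Y by auto
  have RF: "R \<in> measurable ?F M" using Rsp by (rule measurable_vimage_algebra1)
  have hm: "(\<lambda>r. \<integral>y. Y (C (G r) y) \<partial>M) \<in> borel_measurable M"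
    by measurable
  have eq: "(\<integral>y. Y (C (G (R x)) y) \<partial>M) = (\<integral>y. Y (C x y) \<partial>M)" if "x \<in> space M" for x
    using that by (intro Bochner_Integration.integral_cong) (auto simp: CG)
  have "(\<lambda>x. \<integral>y. Y (C (G (R x)) y) \<partial>M) \<in> borel_measurable ?F"
    using measurable_compose[OF RF hm] .
  then show meas: "(\<lambda>x. \<integral>y. Y (C x y) \<partial>M) \<in> borel_measurable ?F"
    by (subst measurable_cong[where g="\<lambda>x. \<integral>y. Y (C (G (R x)) y) \<partial>M"]) (auto simp: eq)
  have sub: "subalgebra M ?F"
    unfolding subalgebra_def using R by (auto simp: sets_vimage_algebra2[OF Rsp])
  interpret F: finite_measure_subalgebra M ?F
    by standard (rule sub)
  have int: "integrable (M \<Otimes>\<^sub>M M) (\<lambda>p. W (case_prod C p))" if "integrable M W" for W :: "'a \<Rightarrow> real"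
    by (rule integrable_distr[OF C]) (simp add: law that)
  have intval: "(\<integral>p. W (case_prod C p) \<partial>(M \<Otimes>\<^sub>M M)) = (\<integral>x. W x \<partial>M)"
    if [measurable]: "W \<in> borel_measurable M" for W :: "'a \<Rightarrow> real"
    by (subst integral_distr[symmetric, OF C]) (simp_all add: law)
  have iY: "integrable M (\<lambda>x. \<integral>y. Y (C x y) \<partial>M)"
    using MM.integrable_fst'[OF int[OF Y]] by simp
  show "AE x in M. real_cond_exp M ?F Y x = (\<integral>y. Y (C x y) \<partial>M)"
  proof (rule F.real_cond_exp_charact[OF _ Y iY meas])
    fix A assume "A \<in> sets ?F"
    then obtain B where B: "B \<in> sets M" "A = R -` B \<inter> space M"
      by (auto simp: sets_vimage_algebra2[OF Rsp])
    have A [measurable]: "A \<in> sets M" using B R by auto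
    have W: "integrable M (\<lambda>x. indicator A x * Y x)"
      using integrable_mult_indicator[OF A Y] by simp
    have mem: "indicator A (C x y) = (indicator A x :: real)" if "x \<in> space M" "y \<in> space M" for x y
    proof -
      have "C x y \<in> space M" using measurable_space[OF C, of "(x, y)"] that by (simp add: space_pair_measure)
      then show ?thesis using that by (simp add: B(2) RC indicator_def)
    qed
    have "(\<integral>x\<in>A. Y x \<partial>M) = (\<integral>p. indicator A (case_prod C p) * Y (case_prod C p) \<partial>(M \<Otimes>\<^sub>M M))"
      unfolding set_lebesgue_integral_def using W by (subst intval) auto
    also have "\<dots> = (\<integral>x. \<integral>y. indicator A (C x y) * Y (C x y) \<partial>M \<partial>M)"
      using MM.integral_fst'[OF int[OF W]] by simp
    also have "\<dots> = (\<integral>x. indicator A x * (\<integral>y. Y (C x y) \<partial>M) \<partial>M)"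
    proof (rule Bochner_Integration.integral_cong[OF refl])
      fix x assume x: "x \<in> space M"
      have "(\<integral>y. indicator A (C x y) * Y (C x y) \<partial>M) = (\<integral>y. indicator A x * Y (C x y) \<partial>M)"
        using x by (intro Bochner_Integration.integral_cong refl) (simp add: mem)
      then show "(\<integral>y. indicator A (C x y) * Y (C x y) \<partial>M) = indicator A x * (\<integral>y. Y (C x y) \<partial>M)"
        by simp
    qed
    finally show "(\<integral>x\<in>A. Y x \<partial>M) = (\<integral>x\<in>A. (\<integral>y. Y (C x y) \<partial>M) \<partial>M)"
      by (simp add: set_lebesgue_integral_def)
  qed
qed

section \<open>The second Borel-Cantelli lemma and slowly growing levels\<close>

text \<open>The probability that none of the events with indices from \<open>m\<close> to \<open>m + n - 1\<close> occurs is a product of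
  factors \<open>1 - p\<^sub>i \<le> exp (- p\<^sub>i)\<close>, and the sum in the exponent diverges.\<close>

lemma (in prob_space) borel_cantelli_divergence:
  assumes ind: "indep_vars N H (UNIV :: nat set)"
    and B: "\<And>i. B i \<in> sets (N i)"
    and div: "\<not> summable (\<lambda>i. prob {x \<in> space M. H i x \<in> B i})"
  shows "AE x in M. \<exists>\<^sub>\<infinity>i. H i x \<in> B i"
proof -
  let ?p = "\<lambda>i. prob {x \<in> space M. H i x \<in> B i}"
  have Hm [measurable]: "H i \<in> measurable M (N i)" for i
    using ind by (auto simp: indep_vars_def)
  have ev [measurable]: "{x \<in> space M. H i x \<in> B i} \<in> events" for i
    using B by measurable
  have "AE x in M. \<not> (\<forall>i\<ge>m. H i x \<notin> B i)" for m
  proof (rule AE_I')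
    let ?N = "{x \<in> space M. \<forall>i\<ge>m. H i x \<notin> B i}"
    have Nm: "?N \<in> events"
      using B by measurable
    have bound: "prob ?N \<le> exp (- sum ?p {m..<m+n})" for n
    proof (cases "n = 0")
      case True then show ?thesis by simp
    next
      case False
      have "prob ?N \<le> prob (\<Inter>i\<in>{m..<m+n}. H i -` (space (N i) - B i) \<inter> space M)"
        using False measurable_space[OF Hm] B
        by (intro finite_measure_mono) (auto intro!: sets.finite_INT measurable_sets[OF Hm])
      also have "\<dots> = (\<Prod>i\<in>{m..<m+n}. prob (H i -` (space (N i) - B i) \<inter> space M))"
        using False B by (intro indep_varsD[OF ind]) auto
      also have "\<dots> = (\<Prod>i\<in>{m..<m+n}. 1 - ?p i)"
      proof (rule prod.cong[OF refl])
        fix i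
        have "H i -` (space (N i) - B i) \<inter> space M = space M - {x \<in> space M. H i x \<in> B i}"
          using measurable_space[OF Hm] by auto
        then show "prob (H i -` (space (N i) - B i) \<inter> space M) = 1 - ?p i"
          by (simp add: prob_compl)
      qed
      also have "\<dots> \<le> (\<Prod>i\<in>{m..<m+n}. exp (- ?p i))"
      proof (rule prod_mono)
        fix i
        show "0 \<le> 1 - ?p i \<and> 1 - ?p i \<le> exp (- ?p i)"
          using exp_ge_add_one_self[of "- ?p i"] by simp
      qed
      finally show ?thesis by (simp only: exp_sum[symmetric] sum_negf finite_atLeastLessThan)
    qed
    have "prob ?N \<le> e" if "e > 0" for e
    proof -
      have "\<not> summable (\<lambda>i. ?p (i + m))" using div summable_iff_shift[of ?p m] by auto
      then obtain n where n: "(\<Sum>i<n. ?p (i + m)) > - ln e"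
        using summableI_nonneg_bounded[of "\<lambda>i. ?p (i + m)" "- ln e"]
        by (force simp: not_less[symmetric])
      have "(\<Sum>i<n. ?p (i + m)) = sum ?p {m..<m+n}"
        by (rule sum.reindex_bij_witness[of _ "\<lambda>i. i - m" "\<lambda>i. i + m"]) auto
      with n have "exp (- sum ?p {m..<m+n}) \<le> exp (ln e)" by simp
      with bound[of n] that show ?thesis by simp
    qed
    then have "prob ?N \<le> 0"
      using field_le_epsilon[of "prob ?N" 0] by (simp only: add_0)
    then have "prob ?N = 0"
      using measure_nonneg[of M ?N] by linarith
    then show "?N \<in> null_sets M"
      using Nm by (simp add: null_sets_def emeasure_eq_measure)
    show "{x \<in> space M. \<not> \<not> (\<forall>i\<ge>m. H i x \<notin> B i)} \<subseteq> ?N" by simp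
  qed
  then have "AE x in M. \<forall>m. \<not> (\<forall>i\<ge>m. H i x \<notin> B i)"
    by (simp add: AE_all_countable)
  then show ?thesis by (rule AE_mp) (auto simp: INFM_nat_le)
qed

text \<open>The largest \<open>r \<le> i\<close> with \<open>p r \<ge> 1 / (i + 1)\<close> serves as \<open>\<rho> i\<close>: the terms
  are then at least of the order of the harmonic series, while every fixed \<open>r\<close> is eventually admissible.
  The value 0 is always allowed as a default.\<close>

lemma slow_divergent_choice:
  fixes p :: "nat \<Rightarrow> real"
  assumes pos: "\<And>r. 0 < p r"
  obtains \<rho> :: "nat \<Rightarrow> nat" where "mono \<rho>" "filterlim \<rho> at_top sequentially" "\<not> summable (\<lambda>i. p (\<rho> i))"
proof
  let ?S = "\<lambda>i. insert 0 {r. r \<le> i \<and> 1 / real (Suc i) \<le> p r}"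
  define \<rho> where "\<rho> i = Max (?S i)" for i
  have fin: "finite (?S i)" for i
    by (rule finite_subset[of _ "{..i}"]) auto
  have mem: "\<rho> i \<in> ?S i" for i
    unfolding \<rho>_def using fin by (intro Max_in) auto
  have ge: "r \<le> \<rho> i" if "r \<in> ?S i" for r i
    unfolding \<rho>_def using fin that by (intro Max_ge) auto
  show "mono \<rho>"
  proof (rule monoI)
    fix i j :: nat assume "i \<le> j"
    then have "1 / real (Suc j) \<le> 1 / real (Suc i)" by (simp add: frac_le)
    with mem[of i] \<open>i \<le> j\<close> have "\<rho> i \<in> ?S j" by force
    then show "\<rho> i \<le> \<rho> j" by (rule ge)
  qed
  show "filterlim \<rho> at_top sequentially"
    unfolding filterlim_at_top
  proof
    fix R
    have "(\<lambda>i. 1 / real (Suc i)) \<longlonglongrightarrow> 0" using LIMSEQ_inverse_real_of_nat by (simp add: inverse_eq_divide)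
    then have "eventually (\<lambda>i. 1 / real (Suc i) < p R) sequentially"
      using pos[of R] by (rule order_tendstoD)
    then show "eventually (\<lambda>i. R \<le> \<rho> i) sequentially"
      using eventually_ge_at_top[of R]
      by eventually_elim (auto intro!: ge)
  qed
  show "\<not> summable (\<lambda>i. p (\<rho> i))"
  proof
    assume "summable (\<lambda>i. p (\<rho> i))"
    moreover have "norm (min 1 (p 0) * (1 / real (Suc i))) \<le> p (\<rho> i)" for i
    proof -
      have a: "min 1 (p 0) * (1 / real (Suc i)) \<le> 1 * (1 / real (Suc i))"
        by (rule mult_right_mono) auto
      have b: "min 1 (p 0) * (1 / real (Suc i)) \<le> p 0 * 1"
        using pos[of 0] by (intro mult_mono) auto
      have "norm (min 1 (p 0) * (1 / real (Suc i))) = min 1 (p 0) * (1 / real (Suc i))"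
        using pos[of 0] by (simp add: abs_mult)
      with a b mem[of i] show ?thesis by (auto simp del: of_nat_Suc)
    qed
    ultimately have "summable (\<lambda>i. min 1 (p 0) * (1 / real (Suc i)))"
      by (rule summable_comparison_test'[where N=0])
    then have "summable (\<lambda>i. (1 / min 1 (p 0)) * (min 1 (p 0) * (1 / real (Suc i))))"
      by (rule summable_mult)
    moreover have "(1 / min 1 (p 0)) * (min 1 (p 0) * (1 / real (Suc i))) = inverse (real (Suc i))" for i
      using pos[of 0] by (auto simp: min_def divide_simps)
    ultimately have "summable (\<lambda>i. inverse (real (Suc i)))" by simp
    then have "summable (\<lambda>i. inverse (real i))" by (subst (asm) summable_Suc_iff)
    then show False using not_summable_harmonic[where 'a=real] by simp
  qed
qed

section \<open>Failure of tightness\<close>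

text \<open>Continuous approximations, countable in number, of the indicator functions of the complements of discs.\<close>

definition ramp :: "nat \<Rightarrow> complex \<Rightarrow> real" where
  "ramp R z = max 0 (min 1 (norm z - real R))"

lemma ramp_bounds: "0 \<le> ramp R z" "ramp R z \<le> 1"
  by (auto simp: ramp_def)

lemma ramp_measurable [measurable]: "ramp R \<in> borel_measurable borel"
  unfolding ramp_def by measurable

lemma continuous_bounded_ramp: "continuous_on UNIV (ramp R) \<and> bounded (range (ramp R))"
proof
  show "continuous_on UNIV (ramp R)" unfolding ramp_def by (intro continuous_intros)
  show "bounded (range (ramp R))"
    by (rule boundedI[of _ 1]) (auto simp: ramp_bounds abs_of_nonneg)
qed

text \<open>Under \<open>Q\<close> the variable \<open>W n\<close> stays within distance 2 of \<open>v n\<close> with probability at least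
  \<open>3 / 4\<close>, by Chebyshev's inequality. Since \<open>v n\<close> escapes from every disc infinitely often, a limit law
  would give mass at least \<open>3 / 4\<close> to the complement of every disc. The measure \<open>P\<close>, which
  stands for another version of the same conditional law, is only compared with \<open>Q\<close> on the test
  functions that this argument uses.\<close>

lemma no_limit_if_means_unbounded:
  fixes W :: "nat \<Rightarrow> 'a \<Rightarrow> complex" and v :: "nat \<Rightarrow> complex"
  assumes Q: "prob_space Q" and W [measurable]: "\<And>n. W n \<in> borel_measurable Q"
    and sq: "\<And>n. integrable Q (\<lambda>x. (norm (W n x - v n))\<^sup>2)"
            "\<And>n. (\<integral>x. (norm (W n x - v n))\<^sup>2 \<partial>Q) \<le> 1"
    and unb: "\<And>R::nat. \<exists>\<^sub>\<infinity>n. real R \<le> norm (v n)"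
    and PQ: "\<And>R n. (\<integral>x. ramp R (W n x) \<partial>P) = (\<integral>x. ramp R (W n x) \<partial>Q)"
  shows "\<not> has_limit_in_distribution P W"
proof
  interpret Q: prob_space Q by fact
  assume "has_limit_in_distribution P W"
  then obtain N where N: "prob_space N" "sets N = sets borel" "converges_in_distribution P W N"
    by (auto simp: has_limit_in_distribution_def)
  interpret N: prob_space N by fact
  have [measurable]: "ramp R \<in> borel_measurable N" for R
    by (simp add: measurable_cong_sets[OF N(2) refl])
  have lim: "(\<lambda>n. \<integral>x. ramp R (W n x) \<partial>Q) \<longlonglongrightarrow> (\<integral>y. ramp R y \<partial>N)" for R
    using N(3)[unfolded converges_in_distribution_def, rule_format, OF continuous_bounded_ramp, of R]
    by (simp only: PQ)
  have large: "3 / 4 \<le> (\<integral>x. ramp R (W n x) \<partial>Q)" if "real (R + 3) \<le> norm (v n)" for R n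
  proof -
    \<comment> \<open>Chebyshev's inequality in integrated form.\<close>
    have pt: "1 - (norm (W n x - v n))\<^sup>2 / 4 \<le> ramp R (W n x)" for x
    proof (cases "norm (W n x - v n) \<le> 2")
      case True
      have "norm (v n) \<le> norm (W n x) + norm (W n x - v n)"
        by (metis norm_minus_commute norm_triangle_sub)
      with True that have "ramp R (W n x) = 1" by (simp add: ramp_def)
      then show ?thesis by simp
    next
      case False
      then have "2\<^sup>2 \<le> (norm (W n x - v n))\<^sup>2" by (intro power_mono) auto
      then show ?thesis using ramp_bounds(1)[of R "W n x"] by simp
    qed
    have "(\<integral>x. 1 - (norm (W n x - v n))\<^sup>2 / 4 \<partial>Q) \<le> (\<integral>x. ramp R (W n x) \<partial>Q)"
      using sq(1)[of n] pt ramp_bounds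
      by (intro integral_mono)
         (auto intro!: Bochner_Integration.integrable_diff Q.integrable_const_bound[where B=1])
    moreover have "(\<integral>x. 1 - (norm (W n x - v n))\<^sup>2 / 4 \<partial>Q) = 1 - (\<integral>x. (norm (W n x - v n))\<^sup>2 \<partial>Q) / 4"
      using sq(1)[of n] by (subst Bochner_Integration.integral_diff) (auto simp: Q.prob_space)
    ultimately show ?thesis using sq(2)[of n] by linarith
  qed
  have lower: "3 / 4 \<le> (\<integral>y. ramp R y \<partial>N)" for R
  proof (rule ccontr)
    assume "\<not> ?thesis"
    then have "eventually (\<lambda>n. (\<integral>x. ramp R (W n x) \<partial>Q) < 3 / 4) sequentially"
      by (intro order_tendstoD(2)[OF lim[of R]]) simp
    then have "\<exists>\<^sub>F n in sequentially. real (R + 3) \<le> norm (v n) \<and> (\<integral>x. ramp R (W n x) \<partial>Q) < 3 / 4"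
      using unb[of "R + 3"] by (intro frequently_eventually_frequently) (simp_all add: cofinite_eq_sequentially)
    then obtain n where "(\<integral>x. ramp R (W n x) \<partial>Q) < 3 / 4" "real (R + 3) \<le> norm (v n)"
      by (auto dest!: frequently_ex)
    with large[of R n] show False by simp
  qed
  have "(\<lambda>R. \<integral>y. ramp R y \<partial>N) \<longlonglongrightarrow> (\<integral>y. 0 \<partial>N)"
  proof (rule integral_dominated_convergence[where w="\<lambda>_. 1"])
    show "AE y in N. (\<lambda>R. ramp R y) \<longlonglongrightarrow> 0"
    proof (rule AE_I2)
      fix y :: complex
      have "eventually (\<lambda>R. ramp R y = 0) sequentially"
        using eventually_ge_at_top[of "nat \<lceil>norm y\<rceil>"]
      proof eventually_elim
        case (elim R)
        then have "norm y \<le> real R" by linarith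
        then show ?case by (simp add: ramp_def)
      qed
      then show "(\<lambda>R. ramp R y) \<longlonglongrightarrow> 0" by (rule tendsto_eventually)
    qed
  qed (auto simp: ramp_bounds abs_of_nonneg)
  then have "3 / 4 \<le> (\<integral>y. 0 \<partial>N :: real)"
    by (rule LIMSEQ_le_const) (rule exI, rule allI, rule impI, rule lower)
  then show False by simp
qed

section \<open>Gaussian white noise\<close>

abbreviation gauss :: "real measure" where
  "gauss \<equiv> std_normal_distribution"

definition noise :: "(int \<Rightarrow> real) measure" where
  "noise = PiM UNIV (\<lambda>_. gauss)"

interpretation gauss: prob_space gauss
  by (rule prob_space_normal_density) simp

interpretation Pi_gauss: product_prob_space "\<lambda>_::int. gauss" UNIV ..

interpretation noise: prob_space noise
  unfolding noise_def by (rule Pi_gauss.P.prob_space_axioms)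

interpretation noise2: pair_prob_space noise noise ..

lemma space_noise [simp]: "space noise = UNIV"
  by (simp add: noise_def space_PiM)

lemma sets_noise: "sets noise = sets (PiM UNIV (\<lambda>_::int. borel :: real measure))"
  unfolding noise_def by (rule sets_PiM_cong) auto

lemma measurable_coordinate [measurable (raw)]: "f \<in> measurable N noise \<Longrightarrow> (\<lambda>x. f x i) \<in> borel_measurable N"
  by (rule measurable_compose[where N=noise])
     (auto simp: measurable_cong_sets[OF sets_noise refl] intro: measurable_component_singleton)

lemma measurable_into_noise:
  assumes "\<And>i. (\<lambda>x. f x i) \<in> borel_measurable N"
  shows "f \<in> measurable N noise"
  using assms by (subst measurable_cong_sets[OF refl sets_noise]) (auto intro!: measurable_PiM_single' simp: space_PiM)

lemma noise_eqI:
  assumes "sets M' = sets noise"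
    and "\<And>J A. finite J \<Longrightarrow> (\<And>i. A i \<in> sets borel) \<Longrightarrow>
           emeasure M' {\<omega>. \<forall>i\<in>J. \<omega> i \<in> A i} = (\<Prod>i\<in>J. emeasure gauss (A i))"
  shows "M' = noise"
  unfolding noise_def
proof (rule Pi_gauss.PiM_eq)
  show "sets M' = sets (PiM UNIV (\<lambda>_. gauss))" using assms(1) by (simp add: noise_def)
  fix J :: "int set" and F :: "int \<Rightarrow> real set"
  assume J: "finite J" and F: "\<And>j. j \<in> J \<Longrightarrow> F j \<in> sets gauss"
  define A where "A i = (if i \<in> J then F i else UNIV)" for i
  have "prod_emb UNIV (\<lambda>_. gauss) J (Pi\<^sub>E J F) = {\<omega>. \<forall>i\<in>J. \<omega> i \<in> A i}"
    by (auto simp: prod_emb_def A_def PiE_iff)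
  moreover have "emeasure M' {\<omega>. \<forall>i\<in>J. \<omega> i \<in> A i} = (\<Prod>i\<in>J. emeasure gauss (A i))"
    using J F by (intro assms(2)) (auto simp: A_def)
  moreover have "(\<Prod>i\<in>J. emeasure gauss (A i)) = (\<Prod>i\<in>J. emeasure gauss (F i))"
    by (rule prod.cong) (auto simp: A_def)
  ultimately show "emeasure M' (prod_emb UNIV (\<lambda>_. gauss) J (Pi\<^sub>E J F)) = (\<Prod>j\<in>J. emeasure gauss (F j))"
    by simp
qed

lemma emeasure_noise_cylinder:
  assumes "finite J" "\<And>i. A i \<in> sets borel"
  shows "emeasure noise {\<omega>. \<forall>i\<in>J. \<omega> i \<in> A i} = (\<Prod>i\<in>J. emeasure gauss (A i))"
  using Pi_gauss.emeasure_PiM_Collect[of J A] assms unfolding noise_def by (simp add: space_PiM)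

lemma cylinder_in_noise [measurable]:
  assumes "finite J" "\<And>i. A i \<in> sets borel"
  shows "{\<omega>. \<forall>i\<in>J. \<omega> i \<in> A i} \<in> sets noise"
proof -
  have "{\<omega>\<in>space noise. \<forall>i\<in>J. \<omega> i \<in> A i} \<in> sets noise"
    using assms by measurable
  then show ?thesis by simp
qed

lemma distr_coordinate: "distr noise borel (\<lambda>\<omega>. \<omega> i) = gauss"
proof -
  have "distr noise gauss (\<lambda>\<omega>. \<omega> i) = gauss"
    unfolding noise_def by (rule Pi_gauss.PiM_component) simp
  moreover have "distr noise gauss (\<lambda>\<omega>. \<omega> i) = distr noise borel (\<lambda>\<omega>. \<omega> i)"
    by (rule distr_cong) auto
  ultimately show ?thesis by simp
qed

lemma indep_coordinates: "noise.indep_vars (\<lambda>_. borel) (\<lambda>i \<omega>. \<omega> i) UNIV"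
proof (subst noise.indep_vars_iff_distr_eq_PiM')
  have "distr noise (PiM UNIV (\<lambda>_. borel)) (\<lambda>\<omega>. \<lambda>i\<in>UNIV. \<omega> i) = distr noise noise (\<lambda>\<omega>. \<omega>)"
    by (rule distr_cong) (auto simp: sets_noise)
  then show "distr noise (PiM UNIV (\<lambda>_. borel)) (\<lambda>\<omega>. \<lambda>i\<in>UNIV. \<omega> i) = PiM UNIV (\<lambda>i. distr noise borel (\<lambda>\<omega>. \<omega> i))"
    by (simp only: distr_coordinate distr_id) (simp add: noise_def)
qed auto

lemma coordinate_moments:
  shows integrable_coordinate: "integrable noise (\<lambda>\<omega>. \<omega> i)"
    and expectation_coordinate: "(\<integral>\<omega>. \<omega> i \<partial>noise) = 0"
    and integrable_coordinate_square: "integrable noise (\<lambda>\<omega>. (\<omega> i)\<^sup>2)"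
    and expectation_coordinate_square: "(\<integral>\<omega>. (\<omega> i)\<^sup>2 \<partial>noise) = 1"
proof -
  have d: "integrable noise (\<lambda>\<omega>. f (\<omega> i)) \<longleftrightarrow> integrable lborel (\<lambda>x. std_normal_density x * f x)"
          "(\<integral>\<omega>. f (\<omega> i) \<partial>noise) = (\<integral>x. std_normal_density x * f x \<partial>lborel)"
    if [measurable]: "f \<in> borel_measurable borel" for f :: "real \<Rightarrow> real"
  proof -
    have "integrable noise (\<lambda>\<omega>. f (\<omega> i)) \<longleftrightarrow> integrable gauss f"
      by (subst distr_coordinate[of i, symmetric]) (simp add: integrable_distr_eq)
    then show "integrable noise (\<lambda>\<omega>. f (\<omega> i)) \<longleftrightarrow> integrable lborel (\<lambda>x. std_normal_density x * f x)"
      by (simp add: integrable_density)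
    have "(\<integral>\<omega>. f (\<omega> i) \<partial>noise) = (\<integral>x. f x \<partial>gauss)"
      by (subst distr_coordinate[of i, symmetric]) (simp add: integral_distr)
    then show "(\<integral>\<omega>. f (\<omega> i) \<partial>noise) = (\<integral>x. std_normal_density x * f x \<partial>lborel)"
      by (simp add: integral_density)
  qed
  show "integrable noise (\<lambda>\<omega>. \<omega> i)"
    using integrable_std_normal_moment[of 1] by (subst d(1)[of "\<lambda>x. x"]) auto
  show "(\<integral>\<omega>. \<omega> i \<partial>noise) = 0"
    using integral_std_normal_moment_odd[of 0] by (subst d(2)[of "\<lambda>x. x"]) auto
  show "integrable noise (\<lambda>\<omega>. (\<omega> i)\<^sup>2)"
    using integrable_std_normal_moment[of 2] by (subst d(1)[of "\<lambda>x. x\<^sup>2"]) auto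
  show "(\<integral>\<omega>. (\<omega> i)\<^sup>2 \<partial>noise) = 1"
    using integral_std_normal_moment_even[of 1] by (subst d(2)[of "\<lambda>x. x\<^sup>2"]) (auto simp: fact_numeral)
qed

lemma coordinates_orthogonal:
  assumes "i \<noteq> j"
  shows "integrable noise (\<lambda>\<omega>. \<omega> i * \<omega> j)" "(\<integral>\<omega>. \<omega> i * \<omega> j \<partial>noise) = 0"
proof -
  have ind: "noise.indep_vars (\<lambda>_. borel) (\<lambda>k \<omega>. \<omega> k) {i, j}"
    by (rule noise.indep_vars_subset[OF indep_coordinates]) simp
  have "(\<integral>\<omega>. (\<Prod>k\<in>{i, j}. \<omega> k) \<partial>noise) = (\<Prod>k\<in>{i, j}. \<integral>\<omega>. \<omega> k \<partial>noise)"
    by (rule noise.indep_vars_lebesgue_integral[OF _ ind]) (auto intro: integrable_coordinate)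
  then show "(\<integral>\<omega>. \<omega> i * \<omega> j \<partial>noise) = 0"
    using assms by (simp add: expectation_coordinate)
  have "integrable noise (\<lambda>\<omega>. (\<Prod>k\<in>{i, j}. \<omega> k))"
    by (rule noise.indep_vars_integrable[OF _ ind]) (auto intro: integrable_coordinate)
  then show "integrable noise (\<lambda>\<omega>. \<omega> i * \<omega> j)"
    using assms by simp
qed

lemma coordinates_covariance:
  shows "integrable noise (\<lambda>\<omega>. \<omega> i * \<omega> j)"
    and "(\<integral>\<omega>. \<omega> i * \<omega> j \<partial>noise) = (if i = j then 1 else 0)"
  using coordinates_orthogonal[of i j] integrable_coordinate_square[of i] expectation_coordinate_square[of i]
  by (auto simp: power2_eq_square)

text \<open>The coordinates are orthonormal.\<close>

lemma square_norm_linear_form: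
  fixes a :: "'i \<Rightarrow> complex" and e :: "'i \<Rightarrow> int"
  assumes B: "finite B" and e: "inj_on e B"
  shows "integrable noise (\<lambda>\<omega>. (norm (\<Sum>k\<in>B. a k * complex_of_real (\<omega> (e k))))\<^sup>2)"
    and "(\<integral>\<omega>. (norm (\<Sum>k\<in>B. a k * complex_of_real (\<omega> (e k))))\<^sup>2 \<partial>noise) = (\<Sum>k\<in>B. (norm (a k))\<^sup>2)"
proof -
  have exp: "(norm (\<Sum>k\<in>B. a k * complex_of_real (\<omega> (e k))))\<^sup>2
     = (\<Sum>k\<in>B. \<Sum>l\<in>B. (Re (a k) * Re (a l) + Im (a k) * Im (a l)) * (\<omega> (e k) * \<omega> (e l)))" for \<omega>
    unfolding cmod_power2 Re_sum Im_sum
    by (simp add: power2_eq_square sum_product sum.distrib[symmetric] algebra_simps)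
  show "integrable noise (\<lambda>\<omega>. (norm (\<Sum>k\<in>B. a k * complex_of_real (\<omega> (e k))))\<^sup>2)"
    unfolding exp by (intro Bochner_Integration.integrable_sum integrable_mult_right coordinates_covariance)
  have "(\<integral>\<omega>. (norm (\<Sum>k\<in>B. a k * complex_of_real (\<omega> (e k))))\<^sup>2 \<partial>noise)
     = (\<Sum>k\<in>B. \<Sum>l\<in>B. (Re (a k) * Re (a l) + Im (a k) * Im (a l)) * (if e k = e l then 1 else 0))"
    unfolding exp
    by (simp add: Bochner_Integration.integral_sum Bochner_Integration.integrable_sum coordinates_covariance)
  also have "\<dots> = (\<Sum>k\<in>B. \<Sum>l\<in>B. if k = l then (norm (a k))\<^sup>2 else 0)"
    using e by (intro sum.cong refl) (auto simp: inj_on_def cmod_power2 simp flip: power2_eq_square)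
  also have "\<dots> = (\<Sum>k\<in>B. (norm (a k))\<^sup>2)" using B by simp
  finally show "(\<integral>\<omega>. (norm (\<Sum>k\<in>B. a k * complex_of_real (\<omega> (e k))))\<^sup>2 \<partial>noise) = (\<Sum>k\<in>B. (norm (a k))\<^sup>2)" .
qed

text \<open>A linear form in independent standard normal variables is normal, so only its variance matters.\<close>

lemma gaussian_linear_form_tail:
  fixes a :: "int \<Rightarrow> real"
  assumes B: "finite B" and pos: "0 < (\<Sum>k\<in>B. (a k)\<^sup>2)"
  shows "measure noise {\<omega>. y \<le> \<bar>\<Sum>k\<in>B. a k * \<omega> k\<bar>} = measure gauss {x. y / sqrt (\<Sum>k\<in>B. (a k)\<^sup>2) \<le> \<bar>x\<bar>}"
proof -
  define s where "s = sqrt (\<Sum>k\<in>B. (a k)\<^sup>2)"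
  \<comment> \<open>Zero coefficients are dropped because the addition theorem for normal laws needs positive variances.\<close>
  let ?B = "{k\<in>B. a k \<noteq> 0}"
  have s: "s > 0" using pos by (simp add: s_def)
  have sB: "(\<Sum>k\<in>?B. (a k)\<^sup>2) = (\<Sum>k\<in>B. (a k)\<^sup>2)" "\<And>\<omega>. (\<Sum>k\<in>?B. a k * \<omega> k) = (\<Sum>k\<in>B. a k * \<omega> k)"
    using B by (auto intro!: sum.mono_neutral_left)
  have "?B \<noteq> {}" using pos sB(1) by force
  have "noise.indep_vars (\<lambda>_. borel) (\<lambda>k \<omega>. \<omega> k) ?B"
    by (rule noise.indep_vars_subset[OF indep_coordinates]) simp
  then have ind: "noise.indep_vars (\<lambda>_. borel) (\<lambda>k \<omega>. a k * \<omega> k) ?B"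
    by (rule noise.indep_vars_compose2) auto
  have coord: "distributed noise lborel (\<lambda>\<omega>. \<omega> i) std_normal_density" for i
    unfolding distributed_def using distr_coordinate[of i]
    by (auto simp: distr_cong[OF refl sets_lborel])
  have "distributed noise lborel (\<lambda>\<omega>. \<Sum>k\<in>?B. a k * \<omega> k) (normal_density (\<Sum>k\<in>?B. 0) (sqrt (\<Sum>k\<in>?B. \<bar>a k\<bar>\<^sup>2)))"
  proof (rule noise.sum_indep_normal[OF _ \<open>?B \<noteq> {}\<close> ind])
    fix k assume k: "k \<in> ?B"
    show "distributed noise lborel (\<lambda>\<omega>. a k * \<omega> k) (normal_density 0 \<bar>a k\<bar>)"
      using noise.normal_density_affine[OF coord[of k], of "a k" 0] k by simp
  qed (use B in auto)
  then have "distributed noise lborel (\<lambda>\<omega>. \<Sum>k\<in>B. a k * \<omega> k) (normal_density 0 s)"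
    by (simp add: sB s_def)
  then have "distributed noise lborel (\<lambda>\<omega>. (\<Sum>k\<in>B. a k * \<omega> k) / s) std_normal_density"
    using noise.normal_standard_normal_convert[OF s, of "\<lambda>\<omega>. \<Sum>k\<in>B. a k * \<omega> k" 0] by simp
  then have "distr noise borel (\<lambda>\<omega>. (\<Sum>k\<in>B. a k * \<omega> k) / s) = gauss"
    unfolding distributed_def by (auto simp: distr_cong[OF refl sets_lborel])
  then have "measure gauss {x. y / s \<le> \<bar>x\<bar>} = measure (distr noise borel (\<lambda>\<omega>. (\<Sum>k\<in>B. a k * \<omega> k) / s)) {x. y / s \<le> \<bar>x\<bar>}"
    by simp
  also have "\<dots> = measure noise ((\<lambda>\<omega>. (\<Sum>k\<in>B. a k * \<omega> k) / s) -` {x. y / s \<le> \<bar>x\<bar>} \<inter> space noise)"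
    by (rule measure_distr) auto
  also have "(\<lambda>\<omega>. (\<Sum>k\<in>B. a k * \<omega> k) / s) -` {x. y / s \<le> \<bar>x\<bar>} \<inter> space noise = {\<omega>. y \<le> \<bar>\<Sum>k\<in>B. a k * \<omega> k\<bar>}"
    using s by (auto simp: divide_le_cancel)
  finally show ?thesis by (simp add: s_def)
qed

lemma gauss_tail_pos: "0 < measure gauss {x. c \<le> \<bar>x\<bar>}" "0 < measure gauss {c..}"
proof -
  have gt: "0 < measure gauss {c..}" for c :: real
  proof -
    have "emeasure gauss {c..} \<noteq> 0"
    proof
      assume "emeasure gauss {c..} = 0"
      then have "AE x in lborel. x \<in> {c..} \<longrightarrow> ennreal (std_normal_density x) = 0"
        by (simp add: emeasure_density nn_integral_0_iff_AE) (auto simp: indicator_def elim!: eventually_mono)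
      then have "AE x in lborel. x \<notin> {c..}"
        by eventually_elim (metis normal_density_pos ennreal_eq_0_iff less_le_not_le zero_less_one)
      then have "emeasure lborel {c..} = 0"
        by (subst (asm) AE_iff_measurable[of "{c..}"]) auto
      moreover have "emeasure lborel {c..c+1} \<le> emeasure lborel {c..}"
        by (rule emeasure_mono) auto
      ultimately show False by simp
    qed
    then show ?thesis
      by (simp add: gauss.emeasure_eq_measure zero_less_measure_iff)
  qed
  show "0 < measure gauss {c..}" by (rule gt)
  have "measure gauss {\<bar>c\<bar>..} \<le> measure gauss {x. c \<le> \<bar>x\<bar>}"
    by (rule gauss.finite_measure_mono) auto
  with gt[of "\<bar>c\<bar>"] show "0 < measure gauss {x. c \<le> \<bar>x\<bar>}" by linarith
qed

section \<open>Resampling the unrevealed coordinates\<close>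

definition graft :: "int set \<Rightarrow> (int \<Rightarrow> real) \<Rightarrow> (int \<Rightarrow> real) \<Rightarrow> int \<Rightarrow> real" where
  "graft K \<omega> \<omega>' i = (if i \<in> K then \<omega> i else \<omega>' i)"

lemma measurable_graft [measurable (raw)]:
  assumes [measurable]: "f \<in> measurable N noise" "g \<in> measurable N noise"
  shows "(\<lambda>x. graft K (f x) (g x)) \<in> measurable N noise"
proof (rule measurable_into_noise)
  fix i show "(\<lambda>x. graft K (f x) (g x) i) \<in> borel_measurable N"
    by (cases "i \<in> K") (simp_all add: graft_def measurable_coordinate)
qed

text \<open>Coordinates are i.i.d., so replacing a fixed set of them by an independent copy preserves the law.\<close>

lemma law_of_graft: "distr (noise \<Otimes>\<^sub>M noise) noise (case_prod (graft K)) = noise"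
proof (rule noise_eqI)
  fix J :: "int set" and A :: "int \<Rightarrow> real set"
  assume J: "finite J" and A: "\<And>i. A i \<in> sets borel"
  let ?E = "\<lambda>I. {\<omega>. \<forall>i\<in>I. \<omega> i \<in> A i}"
  have E [measurable]: "?E I \<in> sets noise" if "finite I" for I
    using that A by (rule cylinder_in_noise)
  have "emeasure (distr (noise \<Otimes>\<^sub>M noise) noise (case_prod (graft K))) (?E J)
      = emeasure (noise \<Otimes>\<^sub>M noise) (case_prod (graft K) -` ?E J \<inter> space (noise \<Otimes>\<^sub>M noise))"
    using E[OF J] by (intro emeasure_distr) auto
  also have "case_prod (graft K) -` ?E J \<inter> space (noise \<Otimes>\<^sub>M noise) = ?E (J \<inter> K) \<times> ?E (J - K)"
    by (auto simp: graft_def space_pair_measure split: if_splits)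
  also have "emeasure (noise \<Otimes>\<^sub>M noise) \<dots> = emeasure noise (?E (J \<inter> K)) * emeasure noise (?E (J - K))"
    using J E by (intro noise.emeasure_pair_measure_Times) auto
  also have "\<dots> = (\<Prod>i\<in>J \<inter> K. emeasure gauss (A i)) * (\<Prod>i\<in>J - K. emeasure gauss (A i))"
    using J A by (simp add: emeasure_noise_cylinder)
  also have "\<dots> = (\<Prod>i\<in>J. emeasure gauss (A i))"
    using J by (subst prod.union_disjoint[symmetric]) (auto intro!: arg_cong2[where f=prod])
  finally show "emeasure (distr (noise \<Otimes>\<^sub>M noise) noise (case_prod (graft K))) (?E J) = (\<Prod>i\<in>J. emeasure gauss (A i))" .
qed simp

lemma nn_integral_graft:
  assumes [measurable]: "F \<in> borel_measurable noise"
  shows "(\<integral>\<^sup>+\<omega>. \<integral>\<^sup>+\<omega>'. F (graft K \<omega> \<omega>') \<partial>noise \<partial>noise) = (\<integral>\<^sup>+\<omega>. F \<omega> \<partial>noise)"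
proof -
  have "(\<integral>\<^sup>+\<omega>. F \<omega> \<partial>noise) = (\<integral>\<^sup>+\<omega>. F \<omega> \<partial>distr (noise \<Otimes>\<^sub>M noise) noise (case_prod (graft K)))"
    by (simp only: law_of_graft)
  also have "\<dots> = (\<integral>\<^sup>+p. F (graft K (fst p) (snd p)) \<partial>(noise \<Otimes>\<^sub>M noise))"
    by (subst nn_integral_distr) (auto simp: case_prod_beta)
  also have "\<dots> = (\<integral>\<^sup>+\<omega>. \<integral>\<^sup>+\<omega>'. F (graft K \<omega> \<omega>') \<partial>noise \<partial>noise)"
    by (subst noise.nn_integral_fst[symmetric]) auto
  finally show ?thesis by simp
qed

text \<open>The coordinates known at time \<open>h\<close>. Site \<open>k\<close> has its value at coordinate \<open>2 * k\<close> and its mark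
  at \<open>2 * k + 1\<close>; for even \<open>i\<close>, \<open>i div 2\<close> is the site and \<open>i + 1\<close> carries its mark. The value
  of a site that lies \<open>j > 0\<close> steps ahead of \<open>h\<close> is known if the mark is at least \<open>\<rho> j\<close>.\<close>

definition revealed :: "(nat \<Rightarrow> real) \<Rightarrow> int \<Rightarrow> (int \<Rightarrow> real) \<Rightarrow> int set" where
  "revealed \<rho> h \<omega> = {i. odd i \<or> i div 2 \<le> h \<or> \<rho> (nat (i div 2 - h)) \<le> \<omega> (i + 1)}"

text \<open>The default value 0 of an unrevealed coordinate cannot be mistaken for a revealed value, because the
  visible marks tell which coordinates are revealed.\<close>

definition observe :: "(nat \<Rightarrow> real) \<Rightarrow> int \<Rightarrow> (int \<Rightarrow> real) \<Rightarrow> int \<Rightarrow> real" where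
  "observe \<rho> h \<omega> = graft (revealed \<rho> h \<omega>) \<omega> (\<lambda>_. 0)"

definition resample :: "(nat \<Rightarrow> real) \<Rightarrow> int \<Rightarrow> (int \<Rightarrow> real) \<Rightarrow> (int \<Rightarrow> real) \<Rightarrow> int \<Rightarrow> real" where
  "resample \<rho> h \<omega> \<omega>' = graft (revealed \<rho> h \<omega>) \<omega> \<omega>'"

definition advance :: "int \<Rightarrow> (int \<Rightarrow> real) \<Rightarrow> int \<Rightarrow> real" where
  "advance h \<omega> i = \<omega> (i + 2 * h)"

lemma odd_revealed: "odd i \<Longrightarrow> i \<in> revealed \<rho> h \<omega>"
  by (simp add: revealed_def)

text \<open>Which coordinates are revealed depends on the marks only, and the marks are always revealed. This
  is why \<open>resample\<close> leaves the observation unchanged.\<close>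

lemma revealed_cong:
  assumes "\<And>i. odd i \<Longrightarrow> \<omega> i = \<omega>' i"
  shows "revealed \<rho> h \<omega> = revealed \<rho> h \<omega>'"
  using assms[of "i + 1" for i] by (auto simp: revealed_def)

lemma revealed_graft:
  assumes "\<And>i. odd i \<Longrightarrow> i \<in> K"
  shows "revealed \<rho> h (graft K \<omega> \<omega>') = revealed \<rho> h \<omega>"
  using assms by (intro revealed_cong) (simp add: graft_def)

lemma observe_resample: "observe \<rho> h (resample \<rho> h \<omega> \<omega>') = observe \<rho> h \<omega>"
  unfolding observe_def resample_def
  by (subst revealed_graft) (auto simp: graft_def odd_revealed fun_eq_iff)

lemma resample_observe: "resample \<rho> h (observe \<rho> h \<omega>) \<omega>' = resample \<rho> h \<omega> \<omega>'"
  unfolding observe_def resample_def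
  by (subst revealed_graft) (auto simp: graft_def odd_revealed fun_eq_iff)

lemma advance_advance: "advance h (advance k \<omega>) = advance (h + k) \<omega>"
  by (simp add: advance_def fun_eq_iff algebra_simps)

lemma advance_0: "advance 0 \<omega> = \<omega>"
  by (simp add: advance_def fun_eq_iff)

lemma revealed_advance: "i \<in> revealed \<rho> 0 (advance h \<omega>) \<longleftrightarrow> i + 2 * h \<in> revealed \<rho> h \<omega>"
  by (simp add: revealed_def advance_def algebra_simps)

lemma observe_advance: "observe \<rho> 0 (advance h \<omega>) = advance h (observe \<rho> h \<omega>)"
  by (simp add: fun_eq_iff observe_def graft_def revealed_advance) (simp add: advance_def observe_def graft_def)

lemma measurable_graft_revealed [measurable (raw)]:
  assumes [measurable]: "e \<in> measurable N noise" "f \<in> measurable N noise" "g \<in> measurable N noise"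
  shows "(\<lambda>x. graft (revealed \<rho> h (e x)) (f x) (g x)) \<in> measurable N noise"
proof (rule measurable_into_noise)
  fix i
  have "(\<lambda>x. if odd i \<or> i div 2 \<le> h \<or> \<rho> (nat (i div 2 - h)) \<le> e x (i + 1) then f x i else g x i) \<in> borel_measurable N"
    by measurable
  then show "(\<lambda>x. graft (revealed \<rho> h (e x)) (f x) (g x) i) \<in> borel_measurable N"
    by (simp add: graft_def revealed_def)
qed

lemma measurable_resample [measurable]: "case_prod (resample \<rho> h) \<in> measurable (noise \<Otimes>\<^sub>M noise) noise"
  unfolding resample_def case_prod_beta by measurable

lemma measurable_resample_right [measurable]: "resample \<rho> h \<omega> \<in> measurable noise noise"
  unfolding resample_def by measurable

lemma measurable_observe [measurable]: "observe \<rho> h \<in> measurable noise noise"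
proof -
  have "(\<lambda>_. \<lambda>_. 0) \<in> measurable noise noise" by (rule measurable_into_noise) simp
  then show ?thesis unfolding observe_def by measurable
qed

lemma measurable_advance [measurable]: "advance h \<in> measurable noise noise"
  unfolding advance_def by (rule measurable_into_noise) (simp add: measurable_coordinate)

lemma distr_advance: "distr noise noise (advance h) = noise"
proof -
  have "distr (PiM UNIV (\<lambda>_. gauss)) (PiM UNIV (\<lambda>_. gauss)) (\<lambda>\<omega>. \<lambda>n\<in>UNIV. \<omega> (n + 2 * h)) = PiM UNIV (\<lambda>_. gauss)"
    by (rule distr_PiM_reindex) (auto simp: gauss.prob_space_axioms inj_on_def)
  then show ?thesis by (simp add: noise_def advance_def[abs_def] restrict_def cong: distr_cong)
qed

text \<open>The set of revealed coordinates is random, but it is determined by the marks. Once these are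
  fixed, \<open>law_of_graft\<close> applies to the remaining coordinates. To express this by iterated
  integrals, the first argument is itself split into marks \<open>\<omega>0\<close> and values \<open>\<omega>1\<close>.\<close>

lemma law_of_resample: "distr (noise \<Otimes>\<^sub>M noise) noise (case_prod (resample \<rho> h)) = noise"
proof (rule measure_eqI)
  fix B assume "B \<in> sets (distr (noise \<Otimes>\<^sub>M noise) noise (case_prod (resample \<rho> h)))"
  then have B [measurable]: "B \<in> sets noise" by simp
  let ?O = "{i::int. odd i}"
  have swap: "resample \<rho> h (graft ?O \<omega>0 \<omega>1) \<omega>' = graft ?O \<omega>0 (graft (revealed \<rho> h \<omega>0) \<omega>1 \<omega>')" for \<omega>0 \<omega>1 \<omega>'
    unfolding resample_def by (subst revealed_graft) (auto simp: graft_def odd_revealed fun_eq_iff)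
  have "emeasure (distr (noise \<Otimes>\<^sub>M noise) noise (case_prod (resample \<rho> h))) B
      = (\<integral>\<^sup>+p. indicator B (case_prod (resample \<rho> h) p) \<partial>(noise \<Otimes>\<^sub>M noise))"
    using nn_integral_distr[OF measurable_resample, of "indicator B" \<rho> h] by simp
  also have "\<dots> = (\<integral>\<^sup>+\<omega>. \<integral>\<^sup>+\<omega>'. indicator B (resample \<rho> h \<omega> \<omega>') \<partial>noise \<partial>noise)"
    by (subst noise.nn_integral_fst[symmetric]) auto
  also have "\<dots> = (\<integral>\<^sup>+\<omega>0. \<integral>\<^sup>+\<omega>1. \<integral>\<^sup>+\<omega>'. indicator B (resample \<rho> h (graft ?O \<omega>0 \<omega>1) \<omega>') \<partial>noise \<partial>noise \<partial>noise)"
    by (rule nn_integral_graft[symmetric]) measurable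
  also have "\<dots> = (\<integral>\<^sup>+\<omega>0. \<integral>\<^sup>+\<omega>2. indicator B (graft ?O \<omega>0 \<omega>2) \<partial>noise \<partial>noise)"
    unfolding swap by (rule nn_integral_cong, rule nn_integral_graft) measurable
  also have "\<dots> = (\<integral>\<^sup>+\<omega>. indicator B \<omega> \<partial>noise)"
    by (rule nn_integral_graft) measurable
  also have "\<dots> = emeasure noise B" by simp
  finally show "emeasure (distr (noise \<Otimes>\<^sub>M noise) noise (case_prod (resample \<rho> h))) B = emeasure noise B" .
qed simp

section \<open>The filtration and the process\<close>

definition past :: "(nat \<Rightarrow> real) \<Rightarrow> (int \<Rightarrow> real) measure" where
  "past \<rho> = vimage_algebra UNIV (observe \<rho> 0) noise"

lemma inv_advance: "inv_into UNIV (advance 1) = advance (- 1)"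
proof (rule inv_equality)
qed (simp_all add: advance_advance advance_0)

lemma bij_advance: "bij (advance h)"
  by (rule o_bij[of "advance (- h)"]) (simp_all add: fun_eq_iff advance_advance advance_0)

lemma advance_power: "(advance h ^^ n) = advance (int n * h)"
proof (induction n)
  case (Suc n)
  then have "(advance h ^^ Suc n) = (\<lambda>\<omega>. advance h (advance (int n * h) \<omega>))"
    by (simp add: comp_def)
  also have "\<dots> = advance (int (Suc n) * h)"
    by (simp add: fun_eq_iff advance_advance algebra_simps)
  finally show ?case .
qed (simp add: fun_eq_iff advance_0)

lemma iterate_advance: "iterate noise (advance 1) k = advance k"
  by (simp add: iterate_def inv_advance advance_power)

lemma process_advance: "process noise (advance 1) (\<lambda>\<omega>. \<omega> 0) k \<omega> = \<omega> (2 * k)"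
  by (simp add: process_def iterate_advance advance_def)

lemma automorphism_advance: "automorphism_of noise (advance 1)"
  by (simp add: automorphism_of_def bij_advance inv_advance distr_advance measurable_advance)

lemma filt_past: "filt noise (advance 1) (past \<rho>) h = vimage_algebra UNIV (\<lambda>\<omega>. observe \<rho> 0 (advance h \<omega>)) noise"
  by (simp add: filt_def iterate_advance past_def vimage_algebra_vimage_algebra_eq)

text \<open>What is observed after a translation by \<open>h\<close> is the translate of what is known at time \<open>h\<close>, so
  resampling the coordinates unknown at time \<open>h\<close> computes conditional expectations at time \<open>h\<close>.\<close>

lemma cond_exp_filt_past:
  assumes "integrable noise Y"
  shows "(\<lambda>\<omega>. \<integral>\<omega>'. Y (resample \<rho> h \<omega> \<omega>') \<partial>noise) \<in> borel_measurable (filt noise (advance 1) (past \<rho>) h)"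
    and "AE \<omega> in noise. real_cond_exp noise (filt noise (advance 1) (past \<rho>) h) Y \<omega>
                          = (\<integral>\<omega>'. Y (resample \<rho> h \<omega> \<omega>') \<partial>noise)"
proof -
  have recover: "advance (- h) (observe \<rho> 0 (advance h \<omega>)) = observe \<rho> h \<omega>" for \<omega>
    by (simp add: observe_advance advance_advance advance_0)
  have "observe \<rho> 0 (advance h (resample \<rho> h x y)) = observe \<rho> 0 (advance h x)" for x y
    by (simp add: observe_advance observe_resample)
  moreover have "resample \<rho> h (advance (- h) (observe \<rho> 0 (advance h x))) y = resample \<rho> h x y" for x y
    by (simp add: recover resample_observe)
  moreover have "(\<lambda>\<omega>. observe \<rho> 0 (advance h \<omega>)) \<in> measurable noise noise" by measurable
  ultimately have *:
    "(\<lambda>\<omega>. \<integral>\<omega>'. Y (resample \<rho> h \<omega> \<omega>') \<partial>noise) \<in> borel_measurable (vimage_algebra (space noise) (\<lambda>\<omega>. observe \<rho> 0 (advance h \<omega>)) noise)"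
    "AE \<omega> in noise. real_cond_exp noise (vimage_algebra (space noise) (\<lambda>\<omega>. observe \<rho> 0 (advance h \<omega>)) noise) Y \<omega>
                          = (\<integral>\<omega>'. Y (resample \<rho> h \<omega> \<omega>') \<partial>noise)"
    using noise.cond_exp_by_resampling[OF _ measurable_advance measurable_resample law_of_resample _ _ assms,
        of "\<lambda>\<omega>. observe \<rho> 0 (advance h \<omega>)" \<rho> h "- h"] by blast+
  show "(\<lambda>\<omega>. \<integral>\<omega>'. Y (resample \<rho> h \<omega> \<omega>') \<partial>noise) \<in> borel_measurable (filt noise (advance 1) (past \<rho>) h)"
    using *(1) by (simp add: filt_past)
  show "AE \<omega> in noise. real_cond_exp noise (filt noise (advance 1) (past \<rho>) h) Y \<omega>
                          = (\<integral>\<omega>'. Y (resample \<rho> h \<omega> \<omega>') \<partial>noise)"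
    using *(2) by (simp add: filt_past)
qed

lemma filt_past_0: "filt noise (advance 1) (past \<rho>) 0 = past \<rho>"
  by (simp only: filt_past advance_0) (simp add: past_def)

lemma decomposition_past: "decomposition noise (past \<rho>) (\<lambda>\<omega>. distr noise noise (resample \<rho> 0 \<omega>))"
  unfolding decomposition_def
proof (intro conjI ballI allI impI)
  fix Y :: "(int \<Rightarrow> real) \<Rightarrow> real" assume Y: "integrable noise Y"
  then have [measurable]: "Y \<in> borel_measurable noise" by auto
  have "(\<integral>x. Y x \<partial>distr noise noise (resample \<rho> 0 \<omega>)) = (\<integral>\<omega>'. Y (resample \<rho> 0 \<omega> \<omega>') \<partial>noise)" for \<omega>
    by (rule integral_distr) auto
  then show "(\<lambda>\<omega>. \<integral>x. Y x \<partial>distr noise noise (resample \<rho> 0 \<omega>)) \<in> borel_measurable (past \<rho>)"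
    and "AE \<omega> in noise. (\<integral>x. Y x \<partial>distr noise noise (resample \<rho> 0 \<omega>)) = real_cond_exp noise (past \<rho>) Y \<omega>"
    using cond_exp_filt_past[OF Y, of \<rho> 0] by (simp_all add: filt_past_0 eq_commute)
qed (auto intro: noise.prob_space_distr)

text \<open>Everything known at time 0 can be read off from what is known at time 1, since the threshold
  for a given site never increases as time moves on.\<close>

lemma generates_filtration_past:
  assumes "mono \<rho>"
  shows "generates_filtration noise (advance 1) (past \<rho>)"
proof -
  have sub: "observe \<rho> 0 (advance (- 1) (observe \<rho> 0 (advance 1 \<omega>))) = observe \<rho> 0 \<omega>" for \<omega>
  proof -
    have inc: "revealed \<rho> 0 \<omega> \<subseteq> revealed \<rho> 1 \<omega>"
    proof
      fix i assume i: "i \<in> revealed \<rho> 0 \<omega>"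
      have "\<rho> (nat (i div 2 - 1)) \<le> \<rho> (nat (i div 2 - 0))"
        by (rule monoD[OF assms]) simp
      with i show "i \<in> revealed \<rho> 1 \<omega>" by (auto simp: revealed_def)
    qed
    have "advance (- 1) (observe \<rho> 0 (advance 1 \<omega>)) = observe \<rho> 1 \<omega>"
      by (simp add: observe_advance advance_advance advance_0)
    moreover have "observe \<rho> 0 (observe \<rho> 1 \<omega>) = observe \<rho> 0 \<omega>"
      unfolding observe_def using inc
      by (subst revealed_graft) (auto simp: graft_def odd_revealed fun_eq_iff)
    ultimately show ?thesis by simp
  qed
  have "past \<rho> = vimage_algebra UNIV (\<lambda>\<omega>. observe \<rho> 0 (advance (- 1) (observe \<rho> 0 (advance 1 \<omega>)))) noise"
    by (simp add: past_def sub)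
  also have "\<dots> = vimage_algebra UNIV (\<lambda>\<omega>. observe \<rho> 0 (advance 1 \<omega>)) (vimage_algebra UNIV (\<lambda>\<omega>. observe \<rho> 0 (advance (- 1) \<omega>)) noise)"
    by (simp add: vimage_algebra_vimage_algebra_eq)
  finally have eq: "past \<rho> = \<dots>" .
  have "sets (vimage_algebra UNIV (\<lambda>\<omega>. observe \<rho> 0 (advance (- 1) \<omega>)) noise) \<subseteq> sets noise"
    by (auto simp: sets_vimage_algebra2 intro!: measurable_sets[of _ noise noise, simplified])
  then have "sets (past \<rho>) \<subseteq> sets (filt noise (advance 1) (past \<rho>) 1)"
    by (subst eq) (auto simp: filt_past sets_vimage_algebra2)
  moreover have "subalgebra noise (past \<rho>)"
    unfolding subalgebra_def past_def
    by (auto simp: sets_vimage_algebra2 intro!: measurable_sets[of _ noise noise, simplified])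
  ultimately show ?thesis by (simp add: generates_filtration_def)
qed

lemma stationary_advance: "stationary noise (process noise (advance 1) (\<lambda>\<omega>. \<omega> 0))"
  unfolding stationary_def process_advance[abs_def]
proof (intro conjI allI)
  fix h :: int
  have [measurable]: "(\<lambda>\<omega> k. \<omega> (2 * k)) \<in> measurable noise (PiM UNIV (\<lambda>_. borel))"
    by (rule measurable_PiM_single') (auto intro: measurable_coordinate)
  have "distr noise (PiM UNIV (\<lambda>_. borel)) (\<lambda>\<omega> k. \<omega> (2 * k))
      = distr (distr noise noise (advance h)) (PiM UNIV (\<lambda>_. borel)) (\<lambda>\<omega> k. \<omega> (2 * k))"
    by (simp add: distr_advance)
  also have "\<dots> = distr noise (PiM UNIV (\<lambda>_. borel)) (\<lambda>\<omega> k. \<omega> (2 * (k + h)))"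
    by (subst distr_distr) (auto simp: comp_def advance_def distrib_left)
  finally show "distr noise (PiM UNIV (\<lambda>_. borel)) (\<lambda>\<omega> k. \<omega> (2 * (k + h))) =
    distr noise (PiM UNIV (\<lambda>_. borel)) (\<lambda>\<omega> k. \<omega> (2 * k))" by simp
qed (simp add: measurable_coordinate)

lemma square_integrable_advance: "square_integrable noise (process noise (advance 1) (\<lambda>\<omega>. \<omega> 0))"
  by (simp add: square_integrable_def process_advance[abs_def] integrable_coordinate_square measurable_coordinate)

lemma adapted_past: "adapted (filt noise (advance 1) (past \<rho>)) (process noise (advance 1) (\<lambda>\<omega>. \<omega> 0))"
  unfolding adapted_def
proof
  fix k :: int
  have "(\<lambda>\<omega>. observe \<rho> 0 (advance k \<omega>) 0) \<in> borel_measurable (filt noise (advance 1) (past \<rho>) k)"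
    unfolding filt_past by (rule measurable_coordinate) (simp add: measurable_vimage_algebra1)
  moreover have "observe \<rho> 0 (advance k \<omega>) 0 = process noise (advance 1) (\<lambda>\<omega>. \<omega> 0) k \<omega>" for \<omega>
    by (simp add: process_advance observe_def graft_def revealed_def advance_def)
  ultimately show "process noise (advance 1) (\<lambda>\<omega>. \<omega> 0) k \<in> borel_measurable (filt noise (advance 1) (past \<rho>) k)"
    by simp
qed

text \<open>The conditional expectation of the value \<open>\<omega> 0\<close> given the information \<open>k > 0\<close> steps before is
  that value where its mark \<open>\<omega> 1\<close> is at least \<open>\<rho> k\<close>, and 0 elsewhere. It tends to 0 by
  dominated convergence.\<close>

lemma regular_process_past:
  assumes \<rho>: "filterlim \<rho> at_top sequentially"
  shows "regular_process noise (filt noise (advance 1) (past \<rho>)) (process noise (advance 1) (\<lambda>\<omega>. \<omega> 0))"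
  unfolding regular_process_def
proof -
  let ?Y = "\<lambda>k \<omega>. if 0 \<in> revealed \<rho> (- int k) \<omega> then (\<omega> 0)\<^sup>2 else (0::real)"
  have [measurable]: "?Y k \<in> borel_measurable noise" for k
    unfolding revealed_def by measurable
  have "(\<integral>\<omega>. \<bar>real_cond_exp noise (filt noise (advance 1) (past \<rho>) (- int k)) (process noise (advance 1) (\<lambda>\<omega>. \<omega> 0) 0) \<omega>\<bar>\<^sup>2 \<partial>noise)
      = (\<integral>\<omega>. ?Y k \<omega> \<partial>noise)" for k
  proof (rule integral_cong_AE)
    show "AE \<omega> in noise. \<bar>real_cond_exp noise (filt noise (advance 1) (past \<rho>) (- int k)) (process noise (advance 1) (\<lambda>\<omega>. \<omega> 0) 0) \<omega>\<bar>\<^sup>2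
        = ?Y k \<omega>"
      using cond_exp_filt_past(2)[OF integrable_coordinate[of 0], of \<rho> "- int k"]
      by eventually_elim
         (simp add: noise.prob_space[simplified] process_advance[abs_def] resample_def graft_def expectation_coordinate)
  qed auto
  moreover have "(\<lambda>k. \<integral>\<omega>. ?Y k \<omega> \<partial>noise) \<longlonglongrightarrow> (\<integral>\<omega>. 0 \<partial>noise)"
  proof (rule integral_dominated_convergence[where w="\<lambda>\<omega>. (\<omega> 0)\<^sup>2"])
    show "AE \<omega> in noise. (\<lambda>k. ?Y k \<omega>) \<longlonglongrightarrow> 0"
    proof (rule AE_I2)
      fix \<omega> :: "int \<Rightarrow> real"
      have "eventually (\<lambda>k. \<omega> 1 < \<rho> k) sequentially"
        using \<rho> by (simp add: filterlim_at_top_dense)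
      then have "eventually (\<lambda>k. ?Y k \<omega> = 0) sequentially"
        using eventually_gt_at_top[of 0] by eventually_elim (simp add: revealed_def)
      then show "(\<lambda>k. ?Y k \<omega>) \<longlonglongrightarrow> 0" by (rule tendsto_eventually)
    qed
  qed (auto simp: integrable_coordinate_square)
  ultimately show "(\<lambda>k. \<integral>\<omega>. \<bar>real_cond_exp noise (filt noise (advance 1) (past \<rho>) (- int k)) (process noise (advance 1) (\<lambda>\<omega>. \<omega> 0) 0) \<omega>\<bar>\<^sup>2 \<partial>noise) \<longlonglongrightarrow> 0"
    by simp
qed

section \<open>The spectral density\<close>

lemma fourier_coefficient_1:
  fixes k :: int
  shows "(\<integral>\<theta>. cis (of_int k * \<theta>) \<partial>uniform_measure lborel {0..<2 * pi}) = (if k = 0 then 1 else 0)"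
proof (cases "k = 0")
  case True
  interpret prob_space "uniform_measure lborel {0..<2 * pi}"
    by (rule prob_space_uniform_measure) auto
  show ?thesis using True prob_space by simp
next
  case False
  have cis_meas: "(\<lambda>\<theta>. cis (of_int k * \<theta>)) \<in> borel_measurable lborel"
    by (simp add: borel_measurable_continuous_onI continuous_intros)
  have "(\<integral>\<theta>. cis (of_int k * \<theta>) \<partial>uniform_measure lborel {0..<2 * pi})
      = (\<integral>\<theta>. (indicator {0..<2 * pi} \<theta> / (2 * pi)) *\<^sub>R cis (of_int k * \<theta>) \<partial>lborel)"
  proof -
    have "uniform_measure lborel {0..<2 * pi} = density lborel (\<lambda>x. ennreal (indicator {0..<2 * pi} x / (2 * pi)))"
      unfolding uniform_measure_def
      by (intro density_cong) (auto simp: divide_ennreal[of 1 "2 * pi", simplified] indicator_def)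
    then show ?thesis using cis_meas by (simp add: integral_density)
  qed
  also have "\<dots> = (\<integral>\<theta>. indicator {0..2 * pi} \<theta> *\<^sub>R ((1 / (2 * pi)) *\<^sub>R cis (of_int k * \<theta>)) \<partial>lborel)"
  proof (rule integral_cong_AE)
    \<comment> \<open>Closing the interval, for the fundamental theorem of calculus, changes the integrand on a null set only.\<close>
    have "AE \<theta> in lborel. \<theta> \<noteq> 2 * pi" by (rule AE_lborel_singleton)
    then show "AE \<theta> in lborel. (indicator {0..<2 * pi} \<theta> / (2 * pi)) *\<^sub>R cis (of_int k * \<theta>)
        = indicator {0..2 * pi} \<theta> *\<^sub>R ((1 / (2 * pi)) *\<^sub>R cis (of_int k * \<theta>))"
      by eventually_elim (auto simp: indicator_def)
  qed (use cis_meas in \<open>auto intro!: borel_measurable_scaleR borel_measurable_divide\<close>)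
  also have "\<dots> = (1 / (2 * pi * \<i> * of_int k)) * cis (of_int k * (2 * pi)) - (1 / (2 * pi * \<i> * of_int k)) * cis (of_int k * 0)"
  proof (rule integral_FTC_Icc)
    fix x :: real
    show "((\<lambda>\<theta>. (1 / (2 * pi * \<i> * of_int k)) * cis (of_int k * \<theta>)) has_vector_derivative (1 / (2 * pi)) *\<^sub>R cis (of_int k * x))
        (at x within {0..2 * pi})"
    proof -
      have "((\<lambda>z. (1 / (2 * pi * \<i> * of_int k)) * exp (\<i> * (of_int k * z))) has_field_derivative
          (1 / (2 * pi)) * exp (\<i> * (of_int k * complex_of_real x))) (at (complex_of_real x) within UNIV)"
        using False by (auto intro!: derivative_eq_intros simp: field_simps)
      then show ?thesis
        using has_vector_derivative_real_field[of "\<lambda>z. (1 / (2 * pi * \<i> * of_int k)) * exp (\<i> * (of_int k * z))" _ x "{0..2 * pi}"]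
        by (simp add: cis_conv_exp scaleR_conv_of_real)
    qed
  qed (auto intro!: continuous_intros)
  also have "\<dots> = 0"
    using cis_multiple_2pi[of "of_int k"] by (simp add: mult_ac)
  finally show ?thesis using False by simp
qed

lemma spectral_density_advance: "spectral_density noise (process noise (advance 1) (\<lambda>\<omega>. \<omega> 0)) (\<lambda>_. 1)"
proof -
  interpret U: prob_space "uniform_measure lborel {0..<2 * pi}"
    by (rule prob_space_uniform_measure) auto
  show ?thesis
    by (auto simp: spectral_density_def process_advance[abs_def] expectation_coordinate coordinates_covariance
        fourier_coefficient_1)
qed

section \<open>Large increments on dyadic blocks\<close>

text \<open>The weights carry half of their maximal energy, and a term is switched off unless its mark is at least
  \<open>r\<close>, which happens with probability \<open>q\<close>. With \<open>n = card B\<close>, the conditional variance \<open>S\<close> given the marks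
  takes values in \<open>[0, n]\<close> and has mean at least \<open>q n / 2\<close>, so it is at least \<open>q n / 4\<close> with probability
  at least \<open>q / 4\<close>. On that event the sum is Gaussian with standard deviation at least \<open>\<surd>(q n / 4)\<close>, and
  \<open>r \<surd>(2 n)\<close> amounts to at most \<open>r \<surd>(8 / q)\<close> standard deviations. The resulting bound is independent of \<open>n\<close>.\<close>

lemma masked_sum_tail:
  fixes w :: "nat \<Rightarrow> real" and r :: real
  defines "q \<equiv> measure gauss {r..}"
  assumes B: "finite B" "B \<noteq> {}" and r: "0 \<le> r"
    and w: "\<And>k. k \<in> B \<Longrightarrow> \<bar>w k\<bar> \<le> 1" and half: "real (card B) \<le> 2 * (\<Sum>k\<in>B. (w k)\<^sup>2)"
  shows "q / 4 * measure gauss {x. r * sqrt (8 / q) \<le> \<bar>x\<bar>}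
    \<le> measure noise {\<omega>. r * sqrt (2 * real (card B))
          \<le> \<bar>\<Sum>k\<in>B. if r \<le> \<omega> (2 * int k + 1) then w k * \<omega> (2 * int k) else 0\<bar>}"
proof -
  define n where "n = real (card B)"
  define S where "S \<omega> = (\<Sum>k\<in>B. (if r \<le> \<omega> (2 * int k + 1) then w k else 0)\<^sup>2)" for \<omega> :: "int \<Rightarrow> real"
  define E where "E = {\<omega>. q * n / 4 \<le> S \<omega>}"
  define y where "y = r * sqrt (2 * n)"
  define A where "A = {\<omega>. y \<le> \<bar>\<Sum>k\<in>B. if r \<le> \<omega> (2 * int k + 1) then w k * \<omega> (2 * int k) else 0\<bar>}"
  define t where "t = measure gauss {x. r * sqrt (8 / q) \<le> \<bar>x\<bar>}"
  have n: "n > 0" using B by (simp add: n_def card_gt_0_iff)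
  have q: "q > 0" unfolding q_def by (rule gauss_tail_pos)
  have [measurable]: "S \<in> borel_measurable noise" unfolding S_def by measurable
  have "{\<omega>\<in>space noise. q * n / 4 \<le> S \<omega>} \<in> sets noise" by measurable
  then have E [measurable]: "E \<in> sets noise" by (simp add: E_def)
  have "{\<omega>\<in>space noise. y \<le> \<bar>\<Sum>k\<in>B. if r \<le> \<omega> (2 * int k + 1) then w k * \<omega> (2 * int k) else 0\<bar>} \<in> sets noise"
    by measurable
  then have A [measurable]: "A \<in> sets noise" by (simp add: A_def)
  have mark: "integrable noise (\<lambda>\<omega>. indicator {r..} (\<omega> i) :: real)" "(\<integral>\<omega>. indicator {r..} (\<omega> i) \<partial>noise) = q" for i
  proof -
    show "integrable noise (\<lambda>\<omega>. indicator {r..} (\<omega> i) :: real)"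
      by (rule noise.integrable_const_bound[where B=1]) auto
    have "(\<integral>\<omega>. indicator {r..} (\<omega> i) \<partial>noise) = (\<integral>x. indicator {r..} x \<partial>distr noise borel (\<lambda>\<omega>. \<omega> i) :: real)"
      by (subst integral_distr) auto
    then show "(\<integral>\<omega>. indicator {r..} (\<omega> i) \<partial>noise) = q"
      by (simp add: distr_coordinate q_def)
  qed
  have S_eq: "S \<omega> = (\<Sum>k\<in>B. (w k)\<^sup>2 * indicator {r..} (\<omega> (2 * int k + 1)))" for \<omega>
    unfolding S_def by (intro sum.cong) auto
  have S_int: "integrable noise S" and "(\<integral>\<omega>. S \<omega> \<partial>noise) = q * (\<Sum>k\<in>B. (w k)\<^sup>2)"
    unfolding S_eq[abs_def] using mark
    by (simp_all add: Bochner_Integration.integral_sum sum_distrib_left mult_ac)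
  then have mean: "q * n / 2 \<le> (\<integral>\<omega>. S \<omega> \<partial>noise)"
    using half q by (simp add: n_def field_simps)
  have "S \<omega> \<le> q * n / 4 + n * indicator E \<omega>" for \<omega>
  proof (cases "\<omega> \<in> E")
    case True
    have "S \<omega> \<le> (\<Sum>k\<in>B. 1)"
      unfolding S_def using w by (intro sum_mono) (auto simp: abs_square_le_1)
    then show ?thesis using True q n by (simp add: n_def add_increasing)
  qed (use n q in \<open>simp add: E_def\<close>)
  then have "(\<integral>\<omega>. S \<omega> \<partial>noise) \<le> (\<integral>\<omega>. q * n / 4 + n * indicator E \<omega> \<partial>noise)"
    using S_int by (intro integral_mono Bochner_Integration.integrable_add integrable_mult_right integrable_real_indicator)
      (auto simp: noise.emeasure_eq_measure)
  also have "\<dots> = q * n / 4 + n * measure noise E"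
    by (subst Bochner_Integration.integral_add) (auto simp: noise.emeasure_eq_measure noise.prob_space[simplified])
  finally have "q / 4 * n \<le> measure noise E * n" using mean by (simp add: field_simps)
  then have PE: "q / 4 \<le> measure noise E" using n by simp
  \<comment> \<open>Conditioning on the marks: they are the odd coordinates and come from \<open>\<omega>0\<close>, the values from \<open>\<omega>1\<close>.\<close>
  let ?O = "{i::int. odd i}"
  have cond: "ennreal t \<le> (\<integral>\<^sup>+\<omega>1. indicator A (graft ?O \<omega>0 \<omega>1) \<partial>noise)" if "\<omega>0 \<in> E" for \<omega>0
  proof -
    define a where "a i = (if r \<le> \<omega>0 (i + 1) then w (nat (i div 2)) else 0)" for i :: int
    let ?D = "(\<lambda>k. 2 * int k) ` B"
    have inj: "inj_on (\<lambda>k. 2 * int k) B" by (auto simp: inj_on_def)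
    have sq: "(\<Sum>i\<in>?D. (a i)\<^sup>2) = S \<omega>0"
      unfolding S_def by (subst sum.reindex[OF inj]) (simp add: a_def cong: if_cong)
    have lin: "(\<Sum>i\<in>?D. a i * \<omega>1 i) = (\<Sum>k\<in>B. if r \<le> \<omega>0 (2 * int k + 1) then w k * \<omega>1 (2 * int k) else 0)" for \<omega>1
      by (subst sum.reindex[OF inj]) (auto simp: a_def intro!: sum.cong)
    have SE: "q * n / 4 \<le> S \<omega>0" using that by (simp add: E_def)
    then have Spos: "0 < S \<omega>0" using q n by (smt (verit) divide_pos_pos mult_pos_pos)
    have graft: "indicator A (graft ?O \<omega>0 \<omega>1) = (indicator {\<omega>1. y \<le> \<bar>\<Sum>i\<in>?D. a i * \<omega>1 i\<bar>} \<omega>1 :: ennreal)" for \<omega>1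
      by (simp add: lin A_def graft_def indicator_def cong: if_cong)
    have "y / sqrt (S \<omega>0) \<le> y / sqrt (q * n / 4)"
      using SE q n r by (intro divide_left_mono) (auto simp: y_def Spos)
    also have "\<dots> = r * sqrt (2 * n / (q * n / 4))"
      unfolding y_def real_sqrt_divide by simp
    also have "2 * n / (q * n / 4) = 8 / q" using n q by (simp add: field_simps)
    finally have yS: "y / sqrt (S \<omega>0) \<le> r * sqrt (8 / q)" .
    have "t \<le> measure gauss {x. y / sqrt (\<Sum>i\<in>?D. (a i)\<^sup>2) \<le> \<bar>x\<bar>}"
      unfolding t_def sq using yS by (intro gauss.finite_measure_mono) auto
    also have "\<dots> = measure noise {\<omega>1. y \<le> \<bar>\<Sum>i\<in>?D. a i * \<omega>1 i\<bar>}"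
      by (rule gaussian_linear_form_tail[symmetric]) (use B Spos in \<open>auto simp: sq\<close>)
    finally have "ennreal t \<le> emeasure noise {\<omega>1. y \<le> \<bar>\<Sum>i\<in>?D. a i * \<omega>1 i\<bar>}"
      by (simp add: noise.emeasure_eq_measure)
    also have "\<dots> = (\<integral>\<^sup>+\<omega>1. indicator A (graft ?O \<omega>0 \<omega>1) \<partial>noise)"
    proof -
      have "{\<omega>1\<in>space noise. y \<le> \<bar>\<Sum>i\<in>?D. a i * \<omega>1 i\<bar>} \<in> sets noise" by measurable
      then show ?thesis unfolding graft by simp
    qed
    finally show ?thesis .
  qed
  have "ennreal (q / 4 * t) \<le> ennreal t * emeasure noise E"
    using mult_right_mono[OF PE, of t]
    by (simp add: noise.emeasure_eq_measure ennreal_mult[symmetric] t_def mult.commute)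
  also have "\<dots> = (\<integral>\<^sup>+\<omega>0. ennreal t * indicator E \<omega>0 \<partial>noise)"
    by (rule nn_integral_cmult_indicator[symmetric]) (rule E)
  also have "\<dots> \<le> (\<integral>\<^sup>+\<omega>0. \<integral>\<^sup>+\<omega>1. indicator A (graft ?O \<omega>0 \<omega>1) \<partial>noise \<partial>noise)"
    by (intro nn_integral_mono) (auto simp: indicator_def intro!: cond[unfolded indicator_def])
  also have "\<dots> = emeasure noise A"
    by (subst nn_integral_graft) auto
  finally have "q / 4 * t \<le> measure noise A"
    by (simp add: noise.emeasure_eq_measure)
  then show ?thesis by (simp add: A_def t_def y_def n_def)
qed

definition dyadic :: "nat \<Rightarrow> nat set" where
  "dyadic i = {2 ^ i..<2 ^ Suc i}"

text \<open>The lower bound of \<open>masked_sum_tail\<close> for the level \<open>r\<close>.\<close>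

definition level_prob :: "nat \<Rightarrow> real" where
  "level_prob r = measure gauss {real r..} / 4
     * measure gauss {x. real r * sqrt (8 / measure gauss {real r..}) \<le> \<bar>x\<bar>}"

lemma level_prob_pos: "0 < level_prob r"
  by (simp add: level_prob_def gauss_tail_pos)

definition threshold :: "(nat \<Rightarrow> nat) \<Rightarrow> nat \<Rightarrow> real" where
  "threshold l k = real (l (floor_log k))"

lemma threshold_dyadic: "k \<in> dyadic i \<Longrightarrow> threshold l k = real (l i)"
  unfolding threshold_def dyadic_def
  by (subst floor_log_eqI[of k i]) (auto intro: less_le_trans[of 0 "2 ^ i"])

lemma mono_threshold: "mono l \<Longrightarrow> mono (threshold l)"
  unfolding threshold_def mono_def by (simp add: floor_log_le_iff)

lemma threshold_at_top:
  assumes "filterlim l at_top sequentially"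
  shows "filterlim (threshold l) at_top sequentially"
proof -
  have "filterlim floor_log at_top sequentially"
    unfolding filterlim_at_top
  proof
    fix m :: nat
    show "eventually (\<lambda>k. m \<le> floor_log k) sequentially"
      using eventually_ge_at_top[of "2 ^ m"]
      by eventually_elim (metis floor_log_le_iff floor_log_power)
  qed
  then show ?thesis
    unfolding threshold_def
    by (intro filterlim_compose[OF filterlim_real_sequentially] filterlim_compose[OF assms])
qed

text \<open>This is the conditional expectation at time 0 of the Fourier sum \<open>S\<^sub>n(\<theta>)\<close>.\<close>

definition predicted_sum :: "(nat \<Rightarrow> real) \<Rightarrow> real \<Rightarrow> nat \<Rightarrow> (int \<Rightarrow> real) \<Rightarrow> complex" where
  "predicted_sum \<rho> \<theta> n \<omega> =
     (\<Sum>k<n. if 2 * int k \<in> revealed \<rho> 0 \<omega> then complex_of_real (\<omega> (2 * int k)) * cis (real k * \<theta>) else 0)"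

text \<open>The increments over different dyadic blocks depend on disjoint sets of coordinates, so they are
  independent and infinitely many of them are large. A large increment over the block from \<open>2\<^sup>i\<close> to
  \<open>2\<^sup>i\<^sup>+\<^sup>1\<close> forces the sum to be large at one of the two ends.\<close>

lemma predicted_sum_unbounded:
  assumes l: "filterlim l at_top sequentially" and div: "\<not> summable (\<lambda>i. level_prob (l i))"
  shows "AE \<omega> in noise. \<forall>R::nat. \<exists>\<^sub>\<infinity>n. real R * sqrt (real n) \<le> norm (predicted_sum (threshold l) \<theta> n \<omega>)"
proof -
  \<comment> \<open>Of the squares of the real and imaginary parts of the exponentials, one family has at least half of the total.\<close>
  define w where "w i k = (if real (2 ^ i) \<le> 2 * (\<Sum>k\<in>dyadic i. (cos (real k * \<theta>))\<^sup>2)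
     then cos (real k * \<theta>) else sin (real k * \<theta>))" for i k
  define H where "H i \<omega> = (\<Sum>k\<in>dyadic i. if real (l i) \<le> \<omega> (2 * int k + 1) then w i k * \<omega> (2 * int k) else 0)"
    for i and \<omega> :: "int \<Rightarrow> real"
  define y where "y i = real (l i) * sqrt (2 * real (2 ^ i))" for i
  have card: "card (dyadic i) = 2 ^ i" for i by (simp add: dyadic_def)
  have fin: "finite (dyadic i)" for i by (simp add: dyadic_def)
  have half: "real (2 ^ i) \<le> 2 * (\<Sum>k\<in>dyadic i. (w i k)\<^sup>2)" for i
  proof -
    have "(\<Sum>k\<in>dyadic i. (cos (real k * \<theta>))\<^sup>2) + (\<Sum>k\<in>dyadic i. (sin (real k * \<theta>))\<^sup>2) = real (2 ^ i)"
      by (simp add: sum.distrib[symmetric] card)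
    then show ?thesis
      by (cases "real (2 ^ i) \<le> 2 * (\<Sum>k\<in>dyadic i. (cos (real k * \<theta>))\<^sup>2)") (simp_all add: w_def)
  qed
  have tail: "level_prob (l i) \<le> measure noise {\<omega>\<in>space noise. H i \<omega> \<in> {x. y i \<le> \<bar>x\<bar>}}" for i
    using masked_sum_tail[of "dyadic i" "real (l i)" "w i"] half[of i] fin[of i] card[of i]
    by (force simp: level_prob_def H_def y_def w_def)
  have nonsum: "\<not> summable (\<lambda>i. measure noise {\<omega>\<in>space noise. H i \<omega> \<in> {x. y i \<le> \<bar>x\<bar>}})"
  proof
    assume *: "summable (\<lambda>i. measure noise {\<omega>\<in>space noise. H i \<omega> \<in> {x. y i \<le> \<bar>x\<bar>}})"
    have "summable (\<lambda>i. level_prob (l i))"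
      by (rule summable_comparison_test'[OF *, of 0]) (use tail level_prob_pos in \<open>simp add: abs_of_pos\<close>)
    with div show False by simp
  qed
  \<comment> \<open>\<open>K i\<close> collects the coordinates of values and marks of the sites in block \<open>i\<close>.\<close>
  define K where "K i = {2 * 2 ^ i..<(4 * 2 ^ i :: int)}" for i :: nat
  have KI: "2 * int k \<in> K i" "2 * int k + 1 \<in> K i" if "k \<in> dyadic i" for k i
  proof -
    have "2 ^ i \<le> k" "k < 2 * 2 ^ i"
      using that by (simp_all add: dyadic_def)
    then have "int (2 ^ i) \<le> int k" "int k < int (2 * 2 ^ i)"
      by (simp_all only: of_nat_le_iff of_nat_less_iff)
    then have "2 ^ i \<le> int k" "int k < 2 * 2 ^ i"
      by simp_all
    then show "2 * int k \<in> K i" "2 * int k + 1 \<in> K i"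
      unfolding K_def atLeastLessThan_iff by linarith+
  qed
  have disj: "disjoint_family K"
  proof -
    have "K i \<inter> K j = {}" if "i < j" for i j
    proof -
      have "(2::int) ^ Suc i \<le> 2 ^ j" by (rule power_increasing) (use that in auto)
      then show ?thesis by (auto simp: K_def)
    qed
    then show ?thesis unfolding disjoint_family_on_def by (metis Int_commute nat_neq_iff)
  qed
  define Y where "Y i \<omega> = (\<Sum>k\<in>dyadic i. if real (l i) \<le> \<omega> (2 * int k + 1) then w i k * \<omega> (2 * int k) else 0)"
    for i and \<omega> :: "int \<Rightarrow> real"
  have "noise.indep_vars (\<lambda>i. PiM (K i) (\<lambda>_. borel)) (\<lambda>i \<omega>. restrict (\<lambda>j. \<omega> j) (K i)) UNIV"
    by (rule noise.indep_vars_restrict[OF indep_coordinates _ disj]) simp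
  then have "noise.indep_vars (\<lambda>_. borel) (\<lambda>i \<omega>. Y i (restrict (\<lambda>j. \<omega> j) (K i))) UNIV"
  proof (rule noise.indep_vars_compose2)
    fix i
    have [measurable]: "(\<lambda>\<omega>. \<omega> (2 * int k)) \<in> borel_measurable (PiM (K i) (\<lambda>_. borel :: real measure))"
        "(\<lambda>\<omega>. \<omega> (2 * int k + 1)) \<in> borel_measurable (PiM (K i) (\<lambda>_. borel :: real measure))" if "k \<in> dyadic i" for k
      using KI[OF that] by (auto intro: measurable_component_singleton)
    show "Y i \<in> borel_measurable (PiM (K i) (\<lambda>_. borel))"
      unfolding Y_def by measurable
  qed
  moreover have "Y i (restrict (\<lambda>j. \<omega> j) (K i)) = H i \<omega>" for i \<omega>
    unfolding Y_def H_def by (intro sum.cong) (auto simp: KI)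
  ultimately have "noise.indep_vars (\<lambda>_. borel) H UNIV" by (simp cong: noise.indep_vars_cong)
  then have "AE \<omega> in noise. \<exists>\<^sub>\<infinity>i. H i \<omega> \<in> {x. y i \<le> \<bar>x\<bar>}"
    by (rule noise.borel_cantelli_divergence[OF _ _ nonsum]) auto
  then show ?thesis
  proof eventually_elim
    case (elim \<omega>)
    \<comment> \<open>The real or the imaginary part of the increment over block \<open>i\<close> is \<open>H i \<omega>\<close>.\<close>
    let ?V = "\<lambda>n. predicted_sum (threshold l) \<theta> n \<omega>"
    have block: "\<bar>H i \<omega>\<bar> \<le> norm (?V (2 ^ Suc i) - ?V (2 ^ i))" for i
    proof -
      define c where "c k = (if real (l i) \<le> \<omega> (2 * int k + 1) then \<omega> (2 * int k) else 0)" for k :: nat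
      have "{..<2 ^ Suc i} = {..<2 ^ i} \<union> dyadic i" "{..<2 ^ i} \<inter> dyadic i = {}"
        by (auto simp: dyadic_def)
      then have "?V (2 ^ Suc i) - ?V (2 ^ i) = (\<Sum>k\<in>dyadic i. if 2 * int k \<in> revealed (threshold l) 0 \<omega>
          then complex_of_real (\<omega> (2 * int k)) * cis (real k * \<theta>) else 0)"
        unfolding predicted_sum_def using fin[of i] by (simp add: sum.union_disjoint)
      also have "\<dots> = (\<Sum>k\<in>dyadic i. complex_of_real (c k) * cis (real k * \<theta>))"
      proof (rule sum.cong[OF refl])
        fix k assume k: "k \<in> dyadic i"
        then have "0 < k" by (auto simp: dyadic_def intro: less_le_trans)
        then show "(if 2 * int k \<in> revealed (threshold l) 0 \<omega>
          then complex_of_real (\<omega> (2 * int k)) * cis (real k * \<theta>) else 0) = complex_of_real (c k) * cis (real k * \<theta>)"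
          by (simp add: revealed_def c_def threshold_dyadic[OF k])
      qed
      finally have V: "?V (2 ^ Suc i) - ?V (2 ^ i) = (\<Sum>k\<in>dyadic i. complex_of_real (c k) * cis (real k * \<theta>))" .
      have "H i \<omega> = Re (?V (2 ^ Suc i) - ?V (2 ^ i)) \<or> H i \<omega> = Im (?V (2 ^ Suc i) - ?V (2 ^ i))"
      proof (cases "real (2 ^ i) \<le> 2 * (\<Sum>k\<in>dyadic i. (cos (real k * \<theta>))\<^sup>2)")
        case True
        then have "H i \<omega> = Re (?V (2 ^ Suc i) - ?V (2 ^ i))"
          unfolding V H_def Re_sum by (intro sum.cong) (auto simp: c_def w_def)
        then show ?thesis ..
      next
        case False
        then have "H i \<omega> = Im (?V (2 ^ Suc i) - ?V (2 ^ i))"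
          unfolding V H_def Im_sum by (intro sum.cong) (auto simp: c_def w_def)
        then show ?thesis ..
      qed
      then show ?thesis using abs_Re_le_cmod abs_Im_le_cmod by metis
    qed
    show ?case
    proof
      fix R :: nat
      have "eventually (\<lambda>i. 2 * R \<le> l i) sequentially"
        using l by (simp add: filterlim_at_top)
      with elim have "\<exists>\<^sub>F i in sequentially. H i \<omega> \<in> {x. y i \<le> \<bar>x\<bar>} \<and> 2 * R \<le> l i"
        by (intro frequently_eventually_frequently) (simp_all add: cofinite_eq_sequentially)
      then have inf: "\<exists>\<^sub>\<infinity>i. H i \<omega> \<in> {x. y i \<le> \<bar>x\<bar>} \<and> 2 * R \<le> l i"
        by (simp add: cofinite_eq_sequentially)
      show "\<exists>\<^sub>\<infinity>n. real R * sqrt (real n) \<le> norm (?V n)"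
        unfolding INFM_nat
      proof
        fix m
        obtain i where i: "m < i" "y i \<le> \<bar>H i \<omega>\<bar>" "2 * R \<le> l i"
          using inf unfolding INFM_nat by auto
        define s where "s = sqrt (real (2 ^ Suc i))"
        have "real (2 * R) * s \<le> real (l i) * s"
          by (rule mult_right_mono) (use i(3) in \<open>auto simp: s_def\<close>)
        also have "\<dots> = y i" by (simp add: y_def s_def)
        also have "\<dots> \<le> norm (?V (2 ^ Suc i) - ?V (2 ^ i))" using i(2) block[of i] by linarith
        also have "\<dots> \<le> norm (?V (2 ^ Suc i)) + norm (?V (2 ^ i))" by (rule norm_triangle_ineq4)
        finally have "real R * s \<le> norm (?V (2 ^ Suc i)) \<or> real R * s \<le> norm (?V (2 ^ i))"
          by auto
        moreover have "real R * sqrt (real (2 ^ i)) \<le> real R * s"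
          by (rule mult_left_mono) (auto simp: s_def)
        moreover have "m < 2 ^ i" "m < 2 ^ Suc i"
          using i(1) less_exp[of i] unfolding power_Suc by linarith+
        ultimately show "\<exists>n>m. real R * sqrt (real n) \<le> norm (?V n)"
          unfolding s_def by (meson order_trans)
      qed
    qed
  qed
qed

section \<open>Absence of quenched limits\<close>

text \<open>A countable family of test functions suffices to exclude a limit, so almost surely \<open>P \<omega>\<close> can
  be exchanged for the explicit conditional law. Under the latter, \<open>Z\<^sub>n(\<theta>)\<close> minus the normalized
  \<open>predicted_sum\<close> is a linear form in the resampled values, with coefficients of modulus at most
  \<open>1 / \<surd>n\<close>.\<close>

lemma no_quenched_limit:
  assumes P: "decomposition noise (past \<rho>) P"
    and unb: "AE \<omega> in noise. \<forall>R::nat. \<exists>\<^sub>\<infinity>n. real R * sqrt (real n) \<le> norm (predicted_sum \<rho> \<theta> n \<omega>)"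
  shows "AE \<omega> in noise. \<not> has_limit_in_distribution (P \<omega>) (Z (process noise (advance 1) (\<lambda>\<omega>. \<omega> 0)) \<theta>)"
proof -
  define W where "W = Z (process noise (advance 1) (\<lambda>\<omega>. \<omega> 0)) \<theta>"
  have W_eq: "W n \<omega> = (1 / complex_of_real (sqrt (real n))) * (\<Sum>k<n. complex_of_real (\<omega> (2 * int k)) * cis (real k * \<theta>))" for n \<omega>
    by (simp add: W_def Z_def process_advance)
  have W [measurable]: "W n \<in> borel_measurable noise" for n
    unfolding W_eq[abs_def] by measurable
  let ?Q = "\<lambda>\<omega>. distr noise noise (resample \<rho> 0 \<omega>)"
  have agree: "AE \<omega> in noise. \<forall>R n. (\<integral>x. ramp R (W n x) \<partial>P \<omega>) = (\<integral>x. ramp R (W n x) \<partial>?Q \<omega>)"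
    unfolding AE_all_countable
  proof (intro allI)
    fix R n
    have "integrable noise (\<lambda>x. ramp R (W n x))"
      by (rule noise.integrable_const_bound[where B=1]) (auto simp: ramp_bounds abs_of_nonneg)
    then have "AE \<omega> in noise. (\<integral>x. ramp R (W n x) \<partial>P \<omega>) = real_cond_exp noise (past \<rho>) (\<lambda>x. ramp R (W n x)) \<omega>"
      "AE \<omega> in noise. (\<integral>x. ramp R (W n x) \<partial>?Q \<omega>) = real_cond_exp noise (past \<rho>) (\<lambda>x. ramp R (W n x)) \<omega>"
      using P decomposition_past[of \<rho>] unfolding decomposition_def by blast+
    then show "AE \<omega> in noise. (\<integral>x. ramp R (W n x) \<partial>P \<omega>) = (\<integral>x. ramp R (W n x) \<partial>?Q \<omega>)"
      by eventually_elim simp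
  qed
  from agree unb show ?thesis
    unfolding W_def[symmetric]
  proof eventually_elim
    case (elim \<omega>)
    define v where "v n = (1 / complex_of_real (sqrt (real n))) * predicted_sum \<rho> \<theta> n \<omega>" for n
    define a where "a n k = (if 2 * int k \<in> revealed \<rho> 0 \<omega> then 0 else (1 / complex_of_real (sqrt (real n))) * cis (real k * \<theta>))"
      for n k :: nat
    have diff: "W n (resample \<rho> 0 \<omega> \<omega>') - v n = (\<Sum>k<n. a n k * complex_of_real (\<omega>' (2 * int k)))" for n \<omega>'
      unfolding W_eq v_def predicted_sum_def right_diff_distrib[symmetric] sum_subtractf[symmetric] sum_distrib_left
      by (intro sum.cong refl) (simp add: a_def resample_def graft_def)
    have inj: "inj_on (\<lambda>k. 2 * int k) {..<n}" for n by (auto simp: inj_on_def)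
    note sq = square_norm_linear_form[OF finite_lessThan inj, of "a n" n for n]
    have small: "(\<Sum>k<n. (norm (a n k))\<^sup>2) \<le> 1" for n
    proof -
      have "(\<Sum>k<n. (norm (a n k))\<^sup>2) \<le> (\<Sum>k<n. 1 / real n)"
        by (rule sum_mono) (simp add: a_def norm_mult norm_divide power_divide)
      also have "\<dots> \<le> 1" by simp
      finally show ?thesis .
    qed
    show "\<not> has_limit_in_distribution (P \<omega>) W"
    proof (rule no_limit_if_means_unbounded[where Q="?Q \<omega>" and v=v])
      show "prob_space (?Q \<omega>)" by (rule noise.prob_space_distr) simp
      show "W n \<in> borel_measurable (?Q \<omega>)" for n by simp
      have m: "(\<lambda>x. (norm (W n x - v n))\<^sup>2) \<in> borel_measurable noise" for n by measurable
      show "integrable (?Q \<omega>) (\<lambda>x. (norm (W n x - v n))\<^sup>2)" for n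
        by (subst integrable_distr_eq[OF _ m]) (simp_all add: diff sq)
      show "(\<integral>x. (norm (W n x - v n))\<^sup>2 \<partial>?Q \<omega>) \<le> 1" for n
        by (subst integral_distr[OF _ m]) (simp_all add: diff sq small)
      show "\<exists>\<^sub>\<infinity>n. real R \<le> norm (v n)" for R
      proof -
        have "\<exists>\<^sub>\<infinity>n. real R * sqrt (real n) \<le> norm (predicted_sum \<rho> \<theta> n \<omega>)" using elim(2) by blast
        then show ?thesis
          unfolding INFM_nat
        proof (intro allI)
          fix m assume "\<forall>m. \<exists>n>m. real R * sqrt (real n) \<le> norm (predicted_sum \<rho> \<theta> n \<omega>)"
          then obtain n where "n > m" "real R * sqrt (real n) \<le> norm (predicted_sum \<rho> \<theta> n \<omega>)" by blast
          then show "\<exists>n>m. real R \<le> norm (v n)"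
            by (intro exI[of _ n]) (auto simp: v_def norm_mult norm_divide field_simps)
        qed
      qed
      show "(\<integral>x. ramp R (W n x) \<partial>P \<omega>) = (\<integral>x. ramp R (W n x) \<partial>?Q \<omega>)" for R n
        using elim(1) by blast
    qed
  qed
qed

theorem theorem4p16p3:
  "\<exists>(M :: (int \<Rightarrow> real) measure) T F0 X0.
     prob_space M \<and>
     automorphism_of M T \<and>
     generates_filtration M T F0 \<and>
     stationary M (process M T X0) \<and>
     square_integrable M (process M T X0) \<and>
     adapted (filt M T F0) (process M T X0) \<and>
     regular_process M (filt M T F0) (process M T X0) \<and>
     (\<exists>f. spectral_density M (process M T X0) f) \<and>
     regular_cond_exp M F0 \<and>
     (\<forall>P. decomposition M F0 P \<longrightarrow>
        (\<forall>\<theta>\<in>{0..<2 * pi}. AE \<omega> in M.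
           \<not> has_limit_in_distribution (P \<omega>) (Z (process M T X0) \<theta>)))"
proof -
  obtain l where l: "mono l" "filterlim l at_top sequentially" "\<not> summable (\<lambda>i. level_prob (l i))"
    using slow_divergent_choice[of level_prob] level_prob_pos by metis
  let ?\<rho> = "threshold l"
  show ?thesis
  proof (rule exI[of _ noise], rule exI[of _ "advance 1"], rule exI[of _ "past ?\<rho>"], rule exI[of _ "\<lambda>\<omega>. \<omega> 0"], intro conjI)
    show "prob_space noise" by (rule noise.prob_space_axioms)
    show "generates_filtration noise (advance 1) (past ?\<rho>)"
      using l(1) by (intro generates_filtration_past mono_threshold)
    show "regular_process noise (filt noise (advance 1) (past ?\<rho>)) (process noise (advance 1) (\<lambda>\<omega>. \<omega> 0))"
      using l(2) by (intro regular_process_past threshold_at_top)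
    show "\<exists>f. spectral_density noise (process noise (advance 1) (\<lambda>\<omega>. \<omega> 0)) f"
      using spectral_density_advance by blast
    show "regular_cond_exp noise (past ?\<rho>)"
      using decomposition_past unfolding regular_cond_exp_def by blast
    show "\<forall>P. decomposition noise (past ?\<rho>) P \<longrightarrow>
        (\<forall>\<theta>\<in>{0..<2 * pi}. AE \<omega> in noise.
           \<not> has_limit_in_distribution (P \<omega>) (Z (process noise (advance 1) (\<lambda>\<omega>. \<omega> 0)) \<theta>))"
      using no_quenched_limit[OF _ predicted_sum_unbounded[OF l(2,3)]] by blast
  qed (rule automorphism_advance stationary_advance square_integrable_advance adapted_past)+
qed

end
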